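(* Let $m>1$ and for $i\in\{1,\dots,m\}$ let $A_i\in\mathbb{R}^{n_i\times n}$, $b_i\in\mathbb{R}^{n_i}$; let $A$ and $b$ be the matrices obtained by stacking $A_1,\dots,A_m$ and $b_1,\dots,b_m$ respectively. Suppose that $Ax=b$ has more than one solution and that $A\neq0$. Let $\mathbb{N}(1),\mathbb{N}(2),\dots$ be a sequence of directed graphs on the vertex set $\{1,\dots,m\}$, each having self-arcs at all vertices, and suppose that each agent $i$ updates its state $x_i(t)\in\mathbb{R}^n$ according to $$x_i(t+1)=x_i(t)-\frac{1}{m_i(t)}P_i\Big(m_i(t)x_i(t)-\sum_{j\in\mathcal{N}_i(t)}x_j(t)\Big),\qquad i\in\{1,\dots,m\},$$ where each state is initialized at a solution of agent $i$'s own equation $A_ix=b_i$. Then there exists a nonnegative constant $\lambda<1$ for which all $x_i(t)$ converge to the same solution to $Ax=b$ as $t\to\infty$ at the same rate as $\lambda^t$ converges to $0$ if and only if the sequence of neighbor graphs $\mathbb{N}(1),\mathbb{N}(2),\dots$ is both repeatedly jointly rooted and repeatedly jointly $\mathcal{D}$-connected.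
   Context: $P_i$ is the orthogonal projection of $\mathbb{R}^n$ onto $\ker A_i$, and $\mathcal{P}_i=\ker A_i$ is its column span. In a directed graph, vertex $j$ is a neighbor of vertex $i$ if $(j,i)$ (an arc from $j$ to $i$) is an arc. $\mathcal{N}_i(t)$ is the set of neighbors of $i$ in $\mathbb{N}(t)$ (it contains $i$) and $m_i(t)$ is its cardinality. Meaning of the convergence rate: convergence is exponential in the uniform sense used for linear time-varying systems: there exist $c>0$ and $\lambda\in[0,1)$ such that for every starting time $t_0\ge 1$ and all initial states $x_1(t_0),\dots,x_m(t_0)$ with $A_ix_i(t_0)=b_i$ for all $i$, there is a solution $\bar x$ of $Ax=b$ (depending on $t_0$ and the initial states) such that the iteration run from time $t_0$ satisfies $\max_i|x_i(t)-\bar x|\le c\,\lambda^{t-t_0}\max_i|x_i(t_0)-\bar x|$ for all $t\ge t_0$ (with $0^0=1$). $\mathcal{D}$-connectivity: let $\mathcal{V}=\{1,\dots,m\}$. A nonempty subset $\mathcal{E}\subset\mathcal{V}$ is partially populated if $\bigcap_{i\in\mathcal{V}}\mathcal{P}_i$ is a proper subset of $\bigcap_{i\in\mathcal{E}}\mathcal{P}_i$. $\mathcal{D}$ is the collection of all partially populated subsets of $\mathcal{V}$. A directed graph $\mathbb{G}$ on $\mathcal{V}$ is $\mathcal{D}$-connected if for every $\mathcal{E}\in\mathcal{D}$ there are $i\in\mathcal{E}$ and $j\in\mathcal{V}\setminus\mathcal{E}$ such that $(j,i)$ is an arc of $\mathbb{G}$. A directed graph is rooted if it contains a directed spanning tree,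 i.e. some vertex from which every other vertex can be reached along a directed path. The composition $\mathbb{G}_q\circ\mathbb{G}_p$ of directed graphs on $\mathcal{V}$ is the directed graph on $\mathcal{V}$ in which $(i,j)$ is an arc iff there is a $k$ with $(i,k)$ an arc of $\mathbb{G}_p$ and $(k,j)$ an arc of $\mathbb{G}_q$. A finite sequence $\mathbb{G}_1,\dots,\mathbb{G}_q$ is jointly $\mathcal{D}$-connected (jointly rooted) if $\mathbb{G}_q\circ\cdots\circ\mathbb{G}_1$ is $\mathcal{D}$-connected (rooted). An infinite sequence $\mathbb{G}_1,\mathbb{G}_2,\dots$ is repeatedly jointly $\mathcal{D}$-connected (repeatedly jointly rooted) if there are positive integers $l,\tau_0$ such that for every integer $k\ge0$ the finite sequence $\mathbb{G}_{\tau_0+kl},\dots,\mathbb{G}_{\tau_0+(k+1)l-1}$ is jointly $\mathcal{D}$-connected (jointly rooted). *)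

theory Defs
  imports "HOL-Analysis.Analysis"
begin

text \<open>
  The number of rows of \<open>A\<^sub>i\<close> depends on \<open>i\<close>, so a matrix with \<open>n = CARD('n)\<close> columns is
  represented by the list of its rows, and a right-hand side by a list of reals of the same length.
  Stacking matrices (or vectors) is then concatenation of lists.
\<close>

type_synonym 'n row_matrix = "(real ^ 'n) list"

definition mat_vec :: "('n::finite) row_matrix \<Rightarrow> real ^ 'n \<Rightarrow> real list" where
  "mat_vec A x = map (\<lambda>r. r \<bullet> x) A"

definition ker :: "('n::finite) row_matrix \<Rightarrow> (real ^ 'n) set" where
  "ker A = {x. mat_vec A x = replicate (length A) 0}"

definition stack :: "nat \<Rightarrow> (nat \<Rightarrow> 'a list) \<Rightarrow> 'a list" where
  "stack m A = concat (map A [1..<Suc m])"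

lemma subspace_ker: "subspace (ker A)"
  by (auto simp: ker_def mat_vec_def subspace_def map_replicate_const[symmetric]
        inner_add_right)

lemma stack_Suc: "stack (Suc m) A = stack m A @ A (Suc m)"
  by (simp add: stack_def)

lemma solves_stack_iff:
  assumes "\<And>i. i \<in> {1..m} \<Longrightarrow> length (b i) = length (A i)"
  shows "mat_vec (stack m A) x = stack m b \<longleftrightarrow> (\<forall>i\<in>{1..m}. mat_vec (A i) x = b i)"
  using assms
proof (induction m)
  case 0
  then show ?case by (simp add: stack_def mat_vec_def)
next
  case (Suc m)
  have "length (mat_vec (A (Suc m)) x) = length (b (Suc m))"
    using Suc.prems[of "Suc m"] by (simp add: mat_vec_def)
  then have "mat_vec (stack (Suc m) A) x = stack (Suc m) b \<longleftrightarrow>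
      mat_vec (stack m A) x = stack m b \<and> mat_vec (A (Suc m)) x = b (Suc m)"
    by (simp add: stack_Suc mat_vec_def append_eq_append_conv)
  also have "\<dots> \<longleftrightarrow> (\<forall>i\<in>{1..Suc m}. mat_vec (A i) x = b i)"
    using Suc by (auto simp: atLeastAtMostSuc_conv)
  finally show ?case .
qed

definition orth_proj :: "(real ^ 'n) set \<Rightarrow> real ^ ('n::finite) ^ 'n" where
  "orth_proj S = (THE P. \<forall>x. P *v x \<in> S \<and> (\<forall>y\<in>S. orthogonal (x - P *v x) y))"

lemma orth_proj_unique:
  fixes S :: "(real ^ 'n::finite) set"
  assumes "subspace S"
  shows "\<exists>!P :: real ^ 'n ^ 'n. \<forall>x. P *v x \<in> S \<and> (\<forall>y\<in>S. orthogonal (x - P *v x) y)"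
proof -
  have uniq: "u = v" if "u \<in> S" "v \<in> S" "\<forall>y\<in>S. orthogonal (x - u) y"
    "\<forall>y\<in>S. orthogonal (x - v) y" for x u v :: "real ^ 'n"
  proof -
    have "u - v \<in> S" using that assms by (simp add: subspace_diff)
    then have "(x - v) \<bullet> (u - v) = 0" "(x - u) \<bullet> (u - v) = 0"
      using that by (auto simp: orthogonal_def)
    then have "(u - v) \<bullet> (u - v) = 0" by (simp add: inner_diff_left)
    then show ?thesis by simp
  qed
  have "\<forall>x. \<exists>u. u \<in> S \<and> (\<forall>y\<in>S. orthogonal (x - u) y)"
  proof
    fix x :: "real ^ 'n"
    obtain u w where "u \<in> span S" "\<And>y. y \<in> span S \<Longrightarrow> orthogonal w y" "x = u + w"
      using orthogonal_subspace_decomp_exists[of S x] by blast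
    then show "\<exists>u. u \<in> S \<and> (\<forall>y\<in>S. orthogonal (x - u) y)"
      using assms span_eq_iff[of S] by (metis add_diff_cancel_left')
  qed
  then obtain f where f: "\<And>x. f x \<in> S" "\<And>x y. y \<in> S \<Longrightarrow> orthogonal (x - f x) y"
    by metis
  have "linear f"
  proof
    fix x y :: "real ^ 'n" and c :: real
    show "f (x + y) = f x + f y"
    proof (rule uniq[of _ _ "x + y"])
      have eq: "x + y - (f x + f y) = (x - f x) + (y - f y)" by simp
      show "\<forall>z\<in>S. orthogonal (x + y - (f x + f y)) z"
        unfolding eq using f by (auto intro: orthogonal_clauses)
    qed (use f assms in \<open>auto simp: subspace_add\<close>)
    show "f (c *\<^sub>R x) = c *\<^sub>R f x"
    proof (rule uniq[of _ _ "c *\<^sub>R x"])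
      have "c *\<^sub>R x - c *\<^sub>R f x = c *\<^sub>R (x - f x)" by (simp add: scaleR_diff_right)
      then show "\<forall>z\<in>S. orthogonal (c *\<^sub>R x - c *\<^sub>R f x) z"
        using f by (simp add: orthogonal_def)
    qed (use f assms in \<open>auto simp: subspace_scale\<close>)
  qed
  then have mf: "matrix f *v x = f x" for x by simp
  show ?thesis
  proof (rule ex1I[of _ "matrix f"])
    show "\<forall>x. matrix f *v x \<in> S \<and> (\<forall>y\<in>S. orthogonal (x - matrix f *v x) y)"
      using f by (simp add: mf)
  next
    fix P :: "real ^ 'n ^ 'n"
    assume "\<forall>x. P *v x \<in> S \<and> (\<forall>y\<in>S. orthogonal (x - P *v x) y)"
    then have "P *v x = matrix f *v x" for x
      using f by (auto simp: mf intro!: uniq[of _ _ x])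
    then show "P = matrix f" by (simp add: matrix_eq)
  qed
qed

text \<open>
  A directed graph on \<open>{1..m}\<close> is its set of arcs, \<open>(i, j)\<close> being an arc from \<open>i\<close> to \<open>j\<close>.
\<close>

definition neighbors :: "(nat \<times> nat) set \<Rightarrow> nat \<Rightarrow> nat set" where
  "neighbors G i = {j. (j, i) \<in> G}"

definition rooted :: "nat \<Rightarrow> (nat \<times> nat) set \<Rightarrow> bool" where
  "rooted m G \<longleftrightarrow> (\<exists>r\<in>{1..m}. \<forall>v\<in>{1..m}. (r, v) \<in> G\<^sup>*)"

definition partially_populated ::
    "nat \<Rightarrow> (nat \<Rightarrow> ('n::finite) row_matrix) \<Rightarrow> nat set \<Rightarrow> bool" where
  "partially_populated m A E \<longleftrightarrow>
     E \<noteq> {} \<and> E \<subseteq> {1..m} \<and> (\<Inter>i\<in>{1..m}. ker (A i)) \<subset> (\<Inter>i\<in>E. ker (A i))"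

definition D_connected ::
    "nat \<Rightarrow> (nat \<Rightarrow> ('n::finite) row_matrix) \<Rightarrow> (nat \<times> nat) set \<Rightarrow> bool" where
  "D_connected m A G \<longleftrightarrow>
     (\<forall>E. partially_populated m A E \<longrightarrow> (\<exists>i\<in>E. \<exists>j\<in>{1..m} - E. (j, i) \<in> G))"

text \<open>
  The composition \<open>G\<^sub>q \<circ> G\<^sub>p\<close> is the relational composition \<open>G\<^sub>p O G\<^sub>q\<close> (in reversed order), so for
  a nonempty list \<open>[G\<^sub>1, \<dots>, G\<^sub>q]\<close> the following is \<open>G\<^sub>q \<circ> \<dots> \<circ> G\<^sub>1\<close>.
\<close>

definition composition :: "(nat \<times> nat) set list \<Rightarrow> (nat \<times> nat) set" where
  "composition Gs = foldr (O) Gs Id"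

definition repeatedly_jointly ::
    "((nat \<times> nat) set \<Rightarrow> bool) \<Rightarrow> (nat \<Rightarrow> (nat \<times> nat) set) \<Rightarrow> bool" where
  "repeatedly_jointly Q N \<longleftrightarrow>
     (\<exists>l \<tau>\<^sub>0. l \<ge> 1 \<and> \<tau>\<^sub>0 \<ge> 1 \<and>
        (\<forall>k. Q (composition (map N [\<tau>\<^sub>0 + k * l ..< \<tau>\<^sub>0 + (k + 1) * l]))))"

definition trajectory_from ::
    "nat \<Rightarrow> nat \<Rightarrow> (nat \<Rightarrow> ('n::finite) row_matrix) \<Rightarrow> (nat \<Rightarrow> (nat \<times> nat) set)
      \<Rightarrow> (nat \<Rightarrow> nat \<Rightarrow> real ^ 'n) \<Rightarrow> bool" where
  "trajectory_from t\<^sub>0 m A N x \<longleftrightarrow>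
     (\<forall>t\<ge>t\<^sub>0. \<forall>i\<in>{1..m}.
        (let mi = real (card (neighbors (N t) i)) in
         x i (t + 1) =
           x i t - (1 / mi) *\<^sub>R
             (orth_proj (ker (A i)) *v (mi *\<^sub>R x i t - (\<Sum>j\<in>neighbors (N t) i. x j t)))))"

definition max_dist :: "nat \<Rightarrow> (nat \<Rightarrow> real ^ ('n::finite)) \<Rightarrow> real ^ 'n \<Rightarrow> real" where
  "max_dist m y z = Max ((\<lambda>i. norm (y i - z)) ` {1..m})"

definition converges_at_rate ::
    "nat \<Rightarrow> (nat \<Rightarrow> ('n::finite) row_matrix) \<Rightarrow> (nat \<Rightarrow> real list)
      \<Rightarrow> (nat \<Rightarrow> (nat \<times> nat) set) \<Rightarrow> real \<Rightarrow> bool" where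
  "converges_at_rate m A b N \<mu> \<longleftrightarrow>
     (\<exists>c>0. \<forall>t\<^sub>0\<ge>1. \<forall>x.
        trajectory_from t\<^sub>0 m A N x \<and> (\<forall>i\<in>{1..m}. mat_vec (A i) (x i t\<^sub>0) = b i) \<longrightarrow>
        (\<exists>z. mat_vec (stack m A) z = stack m b \<and>
           (\<forall>t\<ge>t\<^sub>0. max_dist m (\<lambda>i. x i t) z
                     \<le> c * \<mu> ^ (t - t\<^sub>0) * max_dist m (\<lambda>i. x i t\<^sub>0) z)))"

end

theory Submission
  imports Defs
begin

text \<open>
  Fix a solution \<open>z\<^sub>0\<close> of \<open>A x = b\<close>. The deviations \<open>y\<^sub>i = x\<^sub>i - z\<^sub>0\<close> stay in \<open>ker A\<^sub>i\<close> and obey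
  \<open>y\<^sub>i(t + 1) = P\<^sub>i (mean of y\<^sub>j(t) over the neighbors j of i)\<close>. Let \<open>S\<close> be the common kernel and \<open>Q\<close>
  the orthogonal projection onto it. Since \<open>S\<close> lies in every \<open>ker A\<^sub>i\<close>, \<open>Q\<close> commutes with every
  \<open>P\<^sub>i\<close>, and the dynamics split into two independent parts: \<open>s\<^sub>i = Q y\<^sub>i\<close> evolves by plain averaging,
  and \<open>w\<^sub>i = y\<^sub>i - Q y\<^sub>i\<close> by averaging followed by \<open>P\<^sub>i - Q\<close>. The states converge to one common
  solution exactly when the \<open>w\<^sub>i\<close> tend to zero and the \<open>s\<^sub>i\<close> agree in the limit. The first is
  governed by connectivity with respect to the partially populated sets, the second by rootedness.

  Sufficiency. Both parts are instances of one stability theorem (\<open>exponential_stability\<close>) about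
  averaging followed by linear maps \<open>P\<^sub>a\<close> that behave like orthogonal projections. It asks that within
  every window of fixed length some arc enters each set \<open>E\<close> of indices whose maps share a nonzero
  fixed vector. Strict contraction comes from an equality case: if the largest norm is not reduced, then
  an extremal state equals all the states it was averaged from, so the indices with that value form a
  set that can only shrink, and shrinks whenever an arc enters it (\<open>trajectory_strict\<close>). Compactness
  and the finiteness of the set of graphs make the contraction uniform (\<open>uniform_contraction\<close>). For
  the \<open>w\<^sub>i\<close>, the sets \<open>E\<close> in question are partially populated. For the \<open>s\<^sub>i\<close>, the theorem is applied to
  the differences \<open>s\<^sub>i - s\<^sub>j\<close>, indexed by pairs, with the zero map on the diagonal: a set of pairs off
  the diagonal that is never entered would be reached backwards from a root \<open>r\<close> along both coordinates,
  and so contain \<open>(r, r)\<close>.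

  Necessity. A set of agents with equal states that no arc enters keeps its state
  (\<open>closed_set_frozen\<close>), whereas uniform exponential convergence forces the maximal distance to the
  limit, unless it is zero, to decrease strictly over a long enough window (\<open>window_contraction\<close>). If the composed graph of
  a window has no root, there are two disjoint closed sets, which can be frozen at two different
  solutions. If it fails to be connected with respect to a partially populated set, that set can be
  frozen at \<open>z\<^sub>0 + v\<close> with \<open>v\<close> orthogonal to \<open>S\<close>, which is farther from every solution than \<open>z\<^sub>0\<close>
  is. Either way the maximal distance does not decrease.
\<close>

section \<open>Averaging followed by a projection\<close>

definition preds :: "('a \<times> 'a) set \<Rightarrow> 'a \<Rightarrow> 'a set" where
  "preds G a = {b. (b, a) \<in> G}"

definition mean :: "('a \<Rightarrow> 'v::real_vector) \<Rightarrow> 'a set \<Rightarrow> 'v" where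
  "mean w B = (1 / real (card B)) *\<^sub>R sum w B"

definition avg_step ::
    "('a \<Rightarrow> 'v \<Rightarrow> 'v) \<Rightarrow> ('a \<times> 'a) set \<Rightarrow> ('a \<Rightarrow> 'v::real_vector) \<Rightarrow> 'a \<Rightarrow> 'v" where
  "avg_step P G w = (\<lambda>a. P a (mean w (preds G a)))"

lemma mean_cong: "(\<And>b. b \<in> B \<Longrightarrow> v b = w b) \<Longrightarrow> mean v B = mean w B"
  unfolding mean_def by (simp cong: sum.cong)

lemma mean_singleton: "mean w {a} = w a"
  by (simp add: mean_def)

lemma avg_step_cong:
  "(\<And>b. b \<in> preds G a \<Longrightarrow> v b = w b) \<Longrightarrow> avg_step P G v a = avg_step P G w a"
  unfolding avg_step_def by (metis mean_cong)

lemma mean_linear: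
  assumes "linear f"
  shows "f (mean w B) = mean (\<lambda>b. f (w b)) B"
  unfolding mean_def by (simp add: linear_scale[OF assms] linear_sum[OF assms])

lemma norm_mean_le:
  fixes w :: "'a \<Rightarrow> 'v::real_normed_vector"
  assumes "finite B" "B \<noteq> {}" "\<And>b. b \<in> B \<Longrightarrow> norm (w b) \<le> d"
  shows "norm (mean w B) \<le> d"
proof -
  have "norm (sum w B) \<le> real (card B) * d"
    using sum_norm_bound[of B w d] assms(3) by simp
  moreover have "real (card B) > 0"
    using assms by (simp add: card_gt_0_iff)
  ultimately show ?thesis
    by (simp add: mean_def field_simps)
qed

text \<open>
  This turns differences of averages into averages of differences, which is what makes the
  disagreement of two agents a system of the same kind as the agents themselves.
\<close>

lemma mean_Times_diff:
  fixes s :: "'a \<Rightarrow> 'v::real_vector"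
  assumes "finite B" "finite C" "B \<noteq> {}" "C \<noteq> {}"
  shows "mean (\<lambda>(p, q). s p - s q) (B \<times> C) = mean s B - mean s C"
proof -
  have c: "real (card B) \<noteq> 0" "real (card C) \<noteq> 0"
    using assms by auto
  have "(\<Sum>(p, q)\<in>B \<times> C. s p - s q) = (\<Sum>p\<in>B. \<Sum>q\<in>C. s p - s q)"
    by (simp add: sum.cartesian_product)
  also have "\<dots> = real (card C) *\<^sub>R sum s B - real (card B) *\<^sub>R sum s C"
    by (simp add: sum_subtractf scaleR_sum_right sum_constant_scaleR)
  finally show ?thesis
    using c by (simp add: mean_def card_cartesian_product scaleR_diff_right)
qed

lemma norm_le_if_inner_eq:
  fixes u x :: "'v::real_inner"
  assumes "u \<bullet> x = u \<bullet> u"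
  shows "norm u \<le> norm x"
proof -
  have "norm u * norm u = u \<bullet> x"
    by (simp add: assms power2_norm_eq_inner flip: power2_eq_square)
  also have "\<dots> \<le> norm u * norm x"
    by (rule norm_cauchy_schwarz)
  finally show ?thesis
    by (metis mult_le_cancel_left_pos norm_ge_zero order_le_less)
qed

text \<open>
  The condition \<open>inner_P\<close> holds for every orthogonal projection and is all of its geometry that the
  stability argument uses: it bounds the norm, and it forces the average to equal its image whenever
  the image is as long as the averaged vectors can be.
\<close>

locale projected_averaging =
  fixes I :: "'a set" and P :: "'a \<Rightarrow> 'v::euclidean_space \<Rightarrow> 'v"
  assumes finite_I: "finite I"
    and linear_P: "\<And>a. linear (P a)"
    and inner_P: "\<And>a x. P a x \<bullet> x = P a x \<bullet> P a x"
begin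

definition graph :: "('a \<times> 'a) set \<Rightarrow> bool" where
  "graph G \<longleftrightarrow> G \<subseteq> I \<times> I \<and> (\<forall>a\<in>I. (a, a) \<in> G)"

lemma preds_graph:
  assumes "graph G" "a \<in> I"
  shows "finite (preds G a)" "preds G a \<subseteq> I" "a \<in> preds G a"
proof -
  show "preds G a \<subseteq> I" "a \<in> preds G a"
    using assms by (auto simp: graph_def preds_def)
  then show "finite (preds G a)"
    using finite_I finite_subset by blast
qed

lemma norm_P_le: "norm (P a x) \<le> norm x"
  by (rule norm_le_if_inner_eq[OF inner_P])

lemma norm_avg_step_le:
  assumes "graph G" "\<And>b. b \<in> I \<Longrightarrow> norm (w b) \<le> d" "a \<in> I"
  shows "norm (avg_step P G w a) \<le> d"
proof -
  have "norm (mean w (preds G a)) \<le> d"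
    using preds_graph[OF assms(1,3)] assms(2) by (intro norm_mean_le) auto
  then show ?thesis
    unfolding avg_step_def using norm_P_le order_trans by blast
qed

text \<open>
  The equality case of \<open>norm_avg_step_le\<close>. If \<open>u\<close> is the image of the average and has the maximal norm
  \<open>d\<close>, then the inner products of \<open>u\<close> with the averaged vectors have mean \<open>d\<^sup>2\<close> while none exceeds
  \<open>d\<^sup>2\<close>; so all are equal to \<open>d\<^sup>2\<close>, and Cauchy-Schwarz is sharp.
\<close>

lemma extremal_avg_step:
  assumes "graph G" "\<And>b. b \<in> I \<Longrightarrow> norm (w b) \<le> d" "a \<in> I"
    and u: "avg_step P G w a = u" "norm u = d" and b: "b \<in> preds G a"
  shows "w b = u"
proof -
  let ?B = "preds G a"
  note B = preds_graph[OF assms(1,3)]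
  have c: "real (card ?B) > 0"
    using B by (auto simp: card_gt_0_iff)
  have "u \<bullet> mean w ?B = d\<^sup>2"
    using inner_P[of a "mean w ?B"] u by (simp add: avg_step_def power2_norm_eq_inner[symmetric])
  then have "(\<Sum>b\<in>?B. u \<bullet> w b) = real (card ?B) * d\<^sup>2"
    using c by (simp add: mean_def inner_sum_right field_simps)
  then have "(\<Sum>b\<in>?B. d\<^sup>2 - u \<bullet> w b) = 0"
    by (simp add: sum_subtractf)
  moreover have le: "u \<bullet> w b \<le> d\<^sup>2" if "b \<in> ?B" for b
  proof -
    have "norm (w b) \<le> d" using assms(2) B that by blast
    then have "norm u * norm (w b) \<le> d * d" using u by (intro mult_mono) auto
    then show ?thesis
      using norm_cauchy_schwarz[of u "w b"] by (simp add: power2_eq_square)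
  qed
  ultimately have eq: "u \<bullet> w b = d\<^sup>2"
    using b B(1) by (subst (asm) sum_nonneg_eq_0_iff) auto
  have "norm (w b) \<le> d" using assms(2) B b by blast
  then have "w b \<bullet> w b \<le> d\<^sup>2"
    by (metis norm_ge_zero power2_norm_eq_inner power_mono)
  moreover have "u \<bullet> u = d\<^sup>2" using u by (simp flip: power2_norm_eq_inner)
  ultimately have "(w b - u) \<bullet> (w b - u) \<le> 0"
    using eq by (simp add: inner_diff inner_commute)
  then show ?thesis
    by (metis inner_ge_zero inner_eq_zero_iff order_antisym right_minus_eq)
qed

definition trajectory :: "(nat \<Rightarrow> ('a \<times> 'a) set) \<Rightarrow> nat \<Rightarrow> (nat \<Rightarrow> 'a \<Rightarrow> 'v) \<Rightarrow> bool" where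
  "trajectory G t0 w \<longleftrightarrow> (\<forall>t\<ge>t0. \<forall>a\<in>I. w (Suc t) a = avg_step P (G t) (w t) a)"

definition graphs_from :: "nat \<Rightarrow> (nat \<Rightarrow> ('a \<times> 'a) set) \<Rightarrow> bool" where
  "graphs_from t0 G \<longleftrightarrow> (\<forall>t\<ge>t0. graph (G t))"

definition entered :: "(nat \<Rightarrow> ('a \<times> 'a) set) \<Rightarrow> nat set \<Rightarrow> 'a set \<Rightarrow> bool" where
  "entered G T E \<longleftrightarrow> (\<exists>t\<in>T. \<exists>a\<in>E. \<exists>b\<in>I - E. (b, a) \<in> G t)"

text \<open>
  The hypothesis of the stability theorem. A set \<open>E\<close> whose maps have a common nonzero fixed vector
  \<open>u\<close>, and which no arc enters, could remain at \<open>u\<close> for ever; so such sets have to be entered in every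
  window.
\<close>

definition repeatedly_entered :: "nat \<Rightarrow> nat \<Rightarrow> (nat \<Rightarrow> ('a \<times> 'a) set) \<Rightarrow> bool" where
  "repeatedly_entered t0 L G \<longleftrightarrow> L \<ge> 1 \<and> (\<forall>s\<ge>t0. \<forall>E\<subseteq>I. \<forall>u.
     E \<noteq> {} \<longrightarrow> u \<noteq> 0 \<longrightarrow> (\<forall>a\<in>E. P a u = u) \<longrightarrow> entered G {s..<s + L} E)"

lemma trajectory_norm_le:
  assumes "graphs_from t0 G" "trajectory G t0 w"
    and "\<And>a. a \<in> I \<Longrightarrow> norm (w t0 a) \<le> d" "a \<in> I" "t \<ge> t0"
  shows "norm (w t a) \<le> d"
  using assms(5,4)
proof (induction t arbitrary: a rule: dec_induct)
  case base
  then show ?case using assms(3) by simp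
next
  case (step t)
  then show ?case
    using assms(1,2) norm_avg_step_le[of "G t" "w t" d a] by (simp add: trajectory_def graphs_from_def)
qed

text \<open>
  Suppose a state \<open>u\<close> of norm 1 is left at the end. By the equality case, the set \<open>E t\<close> of indices with
  state \<open>u\<close> at time \<open>t\<close> contains all sources of arcs into \<open>E (Suc t)\<close>. Thus \<open>E\<close> decreases, and it
  cannot be constant over a window, because then no arc would enter it although \<open>u\<close> is fixed by all
  its maps. After as many windows as there are indices, \<open>E\<close> is empty.
\<close>

lemma trajectory_strict:
  assumes grs: "graphs_from t0 G" and tr: "trajectory G t0 w"
    and ini: "\<And>a. a \<in> I \<Longrightarrow> norm (w t0 a) \<le> 1"
    and ent: "repeatedly_entered t0 L G"
    and a: "a \<in> I"
  shows "norm (w (t0 + card I * L) a) < 1"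
proof (rule ccontr)
  define T where "T = t0 + card I * L"
  define u where "u = w T a"
  have gr: "graph (G t)" if "t \<ge> t0" for t
    using grs that by (simp add: graphs_from_def)
  have L: "L \<ge> 1"
    using ent by (simp add: repeatedly_entered_def)
  assume "\<not> ?thesis"
  moreover have le: "norm (w t b) \<le> 1" if "t \<ge> t0" "b \<in> I" for t b
    using trajectory_norm_le[OF grs tr ini] that by blast
  ultimately have nu: "norm u = 1"
    using a by (simp add: u_def T_def order_antisym not_less)
  define E where "E t = {b \<in> I. w t b = u}" for t
  have fin: "finite (E t)" for t
    using finite_I by (simp add: E_def)
  have source: "c \<in> E t" if "b \<in> E (Suc t)" "(c, b) \<in> G t" "t \<ge> t0" for b c t
  proof -
    have "c \<in> I" using gr[OF that(3)] that(2) by (auto simp: graph_def)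
    moreover have "w t c = u"
      using that tr gr[OF that(3)] le nu
      by (intro extremal_avg_step[of "G t" "w t" 1 b u c])
        (auto simp: E_def trajectory_def preds_def)
    ultimately show ?thesis by (simp add: E_def)
  qed
  have fixed: "P b u = u" if "b \<in> E (Suc t)" "t \<ge> t0" for b t
  proof -
    have bI: "b \<in> I" using that by (simp add: E_def)
    note B = preds_graph[OF gr[OF that(2)] bI]
    have "mean (w t) (preds (G t) b) = mean (\<lambda>_. u) (preds (G t) b)"
      using source[OF that(1) _ that(2)] by (intro mean_cong) (auto simp: preds_def E_def)
    also have "\<dots> = u"
      using B by (auto simp: mean_def sum_constant_scaleR card_eq_0_iff)
    finally show ?thesis
      using that bI tr by (simp add: E_def trajectory_def avg_step_def)
  qed
  have dec1: "E (Suc t) \<subseteq> E t" if "t \<ge> t0" for t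
  proof
    fix b assume b: "b \<in> E (Suc t)"
    then have "(b, b) \<in> G t" using gr[OF that] by (simp add: graph_def E_def)
    then show "b \<in> E t" using source b that by blast
  qed
  have dec: "E t' \<subseteq> E t" if "t0 \<le> t" "t \<le> t'" for t t'
    using that(2,1)
  proof (induction t' rule: dec_induct)
    case (step n)
    then show ?case using dec1[of n] by fastforce
  qed simp
  have aE: "a \<in> E t" if "t0 \<le> t" "t \<le> T" for t
    using dec[OF that] a by (auto simp: E_def u_def)
  have shrink: "E (s + L) \<subset> E s" if "s \<ge> t0" "s + L \<le> T" for s
  proof (rule ccontr)
    assume "\<not> ?thesis"
    then have "E (s + L) = E s"
      using dec[of s "s + L"] that by auto
    then have const: "E t = E s" if "s \<le> t" "t \<le> s + L" for t
      using dec[of s t] dec[of t "s + L"] that \<open>s \<ge> t0\<close> by auto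
    have "entered G {s..<s + L} (E s)"
    proof -
      have "E s \<noteq> {}" using aE[of s] that by auto
      moreover have "u \<noteq> 0" using nu by auto
      moreover have "P b u = u" if "b \<in> E s" for b
        using fixed[of b s] const[of "Suc s"] that L \<open>s \<ge> t0\<close> by simp
      moreover have "E s \<subseteq> I" by (auto simp: E_def)
      ultimately show ?thesis
        using ent that by (simp add: repeatedly_entered_def)
    qed
    then obtain t b c where "t \<in> {s..<s + L}" "b \<in> E s" "c \<notin> E s" "(c, b) \<in> G t"
      by (auto simp: entered_def)
    then show False
      using source[of b t c] const[of t] const[of "Suc t"] that by auto
  qed
  have "card (E (t0 + k * L)) + k \<le> card I" if "k \<le> card I" for k
    using that
  proof (induction k)
    case 0
    show ?case using finite_I by (auto simp: E_def intro: card_mono)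
  next
    case (Suc k)
    have "t0 + k * L + L \<le> T"
      using mult_le_mono1[OF Suc.prems, of L] by (simp add: T_def algebra_simps)
    then have "card (E (t0 + k * L + L)) < card (E (t0 + k * L))"
      by (intro psubset_card_mono fin shrink) auto
    then show ?case using Suc by (simp add: algebra_simps)
  qed
  from this[of "card I"] have "E T = {}"
    using fin[of T] by (simp add: T_def)
  then show False using aE[of T] by (simp add: T_def)
qed

lemma continuous_fold_avg_step:
  "continuous_on UNIV (\<lambda>w. fold (avg_step P) Gs w)"
proof (induction Gs)
  case Nil
  then show ?case by (simp add: continuous_on_id)
next
  case (Cons G Gs)
  have "continuous_on UNIV (avg_step P G)"
  proof (rule continuous_on_coordinatewise_then_product)
    fix a
    have "bounded_linear (P a)" using linear_P by (simp add: linear_conv_bounded_linear)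
    then show "continuous_on UNIV (\<lambda>w. avg_step P G w a)"
      unfolding avg_step_def mean_def
      by (intro bounded_linear.continuous_on[of "P a"] continuous_intros
          continuous_on_product_coordinates)
  qed
  from continuous_on_compose2[OF Cons.IH this] show ?case by simp
qed

text \<open>
  Tychonoff's theorem.
\<close>

lemma compact_unit_box: "compact {w :: 'a \<Rightarrow> 'v. \<forall>a. norm (w a) \<le> 1}"
proof -
  have "compactin (product_topology (\<lambda>_. euclidean) (UNIV :: 'a set))
      (PiE UNIV (\<lambda>_. cball (0 :: 'v) 1))"
    unfolding compactin_PiE by (simp add: compactin_euclidean_iff)
  moreover have "PiE UNIV (\<lambda>_. cball (0 :: 'v) 1) = {w :: 'a \<Rightarrow> 'v. \<forall>a. norm (w a) \<le> 1}"
    by (auto simp: PiE_def)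
  ultimately show ?thesis
    by (simp add: euclidean_product_topology compactin_euclidean_iff)
qed

lemma fold_avg_step_scale:
  "fold (avg_step P) Gs (\<lambda>a. c *\<^sub>R w a) = (\<lambda>a. c *\<^sub>R fold (avg_step P) Gs w a)"
proof (induction Gs arbitrary: w)
  case (Cons G Gs)
  have "avg_step P G (\<lambda>a. c *\<^sub>R w a) = (\<lambda>a. c *\<^sub>R avg_step P G w a)"
    by (simp add: avg_step_def mean_def linear_scale[OF linear_P] mult.commute flip: scaleR_sum_right)
  then show ?case using Cons.IH by simp
qed simp

text \<open>
  Each of the finitely many compositions of averaging steps is continuous on a compact set, so it attains
  its maximal norm there, and a pointwise strict bound becomes a uniform one.
\<close>

lemma uniform_contraction:
  assumes "finite Z"
    and strict: "\<And>Gs w a. \<lbrakk>Gs \<in> Z; \<forall>b. norm (w b) \<le> 1; a \<in> I\<rbrakk>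
      \<Longrightarrow> norm (fold (avg_step P) Gs w a) < 1"
  shows "\<exists>\<rho>\<ge>0. \<rho> < 1 \<and> (\<forall>Gs\<in>Z. \<forall>w. (\<forall>b. norm (w b) \<le> 1) \<longrightarrow>
    (\<forall>a\<in>I. norm (fold (avg_step P) Gs w a) \<le> \<rho>))"
proof -
  let ?K = "{w :: 'a \<Rightarrow> 'v. \<forall>a. norm (w a) \<le> 1}"
  have finZ: "finite (Z \<times> I)"
    using assms(1) finite_I by simp
  have "\<exists>r<1. \<forall>w\<in>?K. norm (fold (avg_step P) (fst z) w (snd z)) \<le> r" if z: "z \<in> Z \<times> I" for z
  proof -
    have "continuous_on UNIV (\<lambda>w. norm (fold (avg_step P) (fst z) w (snd z)))"
      by (rule continuous_on_norm[OF continuous_on_product_then_coordinatewise[OF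
            continuous_fold_avg_step]])
    then have cont: "continuous_on ?K (\<lambda>w. norm (fold (avg_step P) (fst z) w (snd z)))"
      by (rule continuous_on_subset) simp
    have "?K \<noteq> {}" by (auto intro: exI[of _ "\<lambda>_. 0"])
    from continuous_attains_sup[OF compact_unit_box this cont] obtain w where
      "w \<in> ?K" "\<forall>v\<in>?K. norm (fold (avg_step P) (fst z) v (snd z))
         \<le> norm (fold (avg_step P) (fst z) w (snd z))" by blast
    moreover have "norm (fold (avg_step P) (fst z) w (snd z)) < 1"
      using strict[of "fst z" w "snd z"] z \<open>w \<in> ?K\<close> by auto
    ultimately show ?thesis by blast
  qed
  then obtain r where r: "\<And>z. z \<in> Z \<times> I \<Longrightarrow> r z < 1"
    "\<And>z w. z \<in> Z \<times> I \<Longrightarrow> w \<in> ?K \<Longrightarrow> norm (fold (avg_step P) (fst z) w (snd z)) \<le> r z"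
    by metis
  define \<rho> where "\<rho> = Max (insert 0 (r ` (Z \<times> I)))"
  have fin: "finite (insert 0 (r ` (Z \<times> I)))" using finZ by simp
  show ?thesis
  proof (intro exI[of _ \<rho>] conjI allI impI ballI)
    show "\<rho> < 1" unfolding \<rho>_def using fin r(1) by (subst Max_less_iff) auto
    show "\<rho> \<ge> 0" unfolding \<rho>_def using fin by (intro Max_ge) auto
    fix Gs and w :: "'a \<Rightarrow> 'v" and a
    assume "Gs \<in> Z" and w: "\<forall>b. norm (w b) \<le> 1" and "a \<in> I"
    then have z: "(Gs, a) \<in> Z \<times> I" by simp
    have "norm (fold (avg_step P) Gs w a) \<le> r (Gs, a)" using r(2)[OF z, of w] w by simp
    also have "\<dots> \<le> \<rho>" unfolding \<rho>_def using fin z by (intro Max_ge) blast+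
    finally show "norm (fold (avg_step P) Gs w a) \<le> \<rho>" .
  qed
qed

lemma trajectory_eq_fold:
  assumes gr: "graphs_from t0 G" and tr: "trajectory G t0 w"
    and v: "\<And>a. a \<in> I \<Longrightarrow> v a = w t0 a" and a: "a \<in> I"
  shows "w (t0 + k) a = fold (avg_step P) (map G [t0..<t0 + k]) v a"
  using a
proof (induction k arbitrary: a)
  case (Suc k)
  let ?f = "\<lambda>k. fold (avg_step P) (map G [t0..<t0 + k]) v"
  have "w (t0 + Suc k) a = avg_step P (G (t0 + k)) (w (t0 + k)) a"
    using tr Suc.prems by (simp add: trajectory_def)
  also have "\<dots> = avg_step P (G (t0 + k)) (?f k) a"
    using Suc.IH preds_graph(2)[of "G (t0 + k)" a] gr Suc.prems
    by (intro avg_step_cong) (auto simp: graphs_from_def)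
  finally show ?case by simp
qed (use v in simp)

text \<open>
  There are infinitely many starting times but only finitely many lists of graphs of the given length,
  which is why one factor serves all starting times. The general bound \<open>d\<close> is reduced to \<open>1\<close> by
  scaling.
\<close>

lemma trajectory_contraction:
  assumes gr: "graphs_from 1 G" and ent: "repeatedly_entered 1 L G"
  shows "\<exists>\<rho>\<ge>0. \<rho> < 1 \<and> (\<forall>t0\<ge>1. \<forall>w d. trajectory G t0 w \<longrightarrow> (\<forall>a\<in>I. norm (w t0 a) \<le> d) \<longrightarrow>
    (\<forall>a\<in>I. norm (w (t0 + card I * L) a) \<le> \<rho> * d))"
proof -
  define T where "T = card I * L"
  define Z where "Z = {map G [t0..<t0 + T] | t0. t0 \<ge> 1}"
  have sub: "G t \<in> Pow (I \<times> I)" if "t \<ge> 1" for t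
    using gr that by (simp add: graphs_from_def graph_def)
  have "Z \<subseteq> {Gs. set Gs \<subseteq> Pow (I \<times> I) \<and> length Gs = T}"
  proof
    fix Gs assume "Gs \<in> Z"
    then obtain t0 where "t0 \<ge> 1" "Gs = map G [t0..<t0 + T]" by (auto simp: Z_def)
    moreover have "G t \<in> Pow (I \<times> I)" if "t \<in> {t0..<t0 + T}" for t
      using sub[of t] that \<open>t0 \<ge> 1\<close> by simp
    then have "G ` {t0..<t0 + T} \<subseteq> Pow (I \<times> I)" by (rule image_subsetI)
    ultimately show "Gs \<in> {Gs. set Gs \<subseteq> Pow (I \<times> I) \<and> length Gs = T}"
      by simp
  qed
  moreover have "finite {Gs. set Gs \<subseteq> Pow (I \<times> I) \<and> length Gs = T}"
    using finite_I by (intro finite_lists_length_eq) simp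
  ultimately have finZ: "finite Z"
    by (rule finite_subset)
  have strict: "norm (fold (avg_step P) Gs v a) < 1"
    if Z: "Gs \<in> Z" and v: "\<forall>b. norm (v b) \<le> 1" and a: "a \<in> I" for Gs v a
  proof -
    obtain t0 where t0: "t0 \<ge> 1" "Gs = map G [t0..<t0 + T]"
      using Z by (auto simp: Z_def)
    have gr0: "graphs_from t0 G" and ent0: "repeatedly_entered t0 L G"
      using gr ent t0 by (simp_all add: graphs_from_def repeatedly_entered_def)
    define v' where "v' t = fold (avg_step P) (map G [t0..<t]) v" for t
    have tr: "trajectory G t0 v'"
      unfolding trajectory_def v'_def by simp
    have "norm (v' t0 b) \<le> 1" for b
      using v by (simp add: v'_def)
    then have "norm (v' (t0 + card I * L) a) < 1"
      by (rule trajectory_strict[OF gr0 tr _ ent0 a])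
    then show ?thesis by (simp add: v'_def T_def t0)
  qed
  obtain \<rho> where \<rho>: "0 \<le> \<rho>" "\<rho> < 1"
    "\<And>Gs w a. \<lbrakk>Gs \<in> Z; \<forall>b. norm (w b) \<le> 1; a \<in> I\<rbrakk>
      \<Longrightarrow> norm (fold (avg_step P) Gs w a) \<le> \<rho>"
    using uniform_contraction[OF finZ strict] by blast
  show ?thesis
  proof (intro exI[of _ \<rho>] conjI allI impI ballI \<rho>(1,2))
    fix t0 w d a
    assume t0: "t0 \<ge> 1" and tr: "trajectory G t0 w"
      and d': "\<forall>a\<in>I. norm (w t0 a) \<le> d" and a: "a \<in> I"
    have d: "norm (w t0 a) \<le> d" if "a \<in> I" for a using d' that by blast
    let ?Gs = "map G [t0..<t0 + T]"
    have GsZ: "?Gs \<in> Z" using t0 by (auto simp: Z_def)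
    have gr0: "graphs_from t0 G"
      using gr t0 by (simp add: graphs_from_def)
    have pos: "norm (w (t0 + T) a) \<le> \<rho> * e" if e: "e > 0" "e \<ge> d" for e
    proof -
      \<comment> \<open>The compact set constrains all coordinates, so those outside \<open>I\<close>, which no step reads,
        are set to zero.\<close>
      define v where "v a = (if a \<in> I then w t0 a else 0)" for a
      have "norm ((1 / e) *\<^sub>R v b) \<le> 1" for b
        using d[of b] e by (auto simp: v_def)
      then have "norm (fold (avg_step P) ?Gs (\<lambda>b. (1 / e) *\<^sub>R v b) a) \<le> \<rho>"
        by (intro \<rho>(3)[OF GsZ _ a]) blast
      then have "norm (fold (avg_step P) ?Gs v a) \<le> \<rho> * e"
        using e by (simp add: fold_avg_step_scale field_simps)
      then show ?thesis
        using trajectory_eq_fold[OF gr0 tr _ a, of v T] by (simp add: v_def)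
    qed
    have "d \<ge> 0" using d[OF a] norm_ge_zero order_trans by blast
    show "norm (w (t0 + card I * L) a) \<le> \<rho> * d"
    proof (cases "d = 0")
      case True
      \<comment> \<open>Scaling by \<open>1 / d\<close> is impossible here, so \<open>d\<close> is approximated from above.\<close>
      have "norm (w (t0 + T) a) \<le> \<rho> * 0"
      proof (rule field_le_epsilon)
        fix e :: real assume "e > 0"
        then have "\<rho> * e \<le> 1 * e" using \<rho> by (intro mult_right_mono) auto
        then show "norm (w (t0 + T) a) \<le> \<rho> * 0 + e"
          using pos[of e] True \<open>e > 0\<close> by linarith
      qed
      then show ?thesis using True by (simp add: T_def)
    next
      case False
      then show ?thesis using pos[of d] \<open>d \<ge> 0\<close> by (simp add: T_def)
    qed
  qed
qed

text \<open>
  The contraction over one window is iterated, and the norm does not grow inside the last,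
  incomplete window; the constant \<open>C\<close> pays for that window.
\<close>

theorem exponential_stability:
  assumes gr: "graphs_from 1 G" and ent: "repeatedly_entered 1 L G" and I: "I \<noteq> {}"
  shows "\<exists>C>0. \<exists>l>0. l < 1 \<and> (\<forall>t0\<ge>1. \<forall>w d. trajectory G t0 w \<longrightarrow>
    (\<forall>a\<in>I. norm (w t0 a) \<le> d) \<longrightarrow> (\<forall>k. \<forall>a\<in>I. norm (w (t0 + k) a) \<le> C * l ^ k * d))"
proof -
  define T where "T = card I * L"
  have "L \<ge> 1" using ent unfolding repeatedly_entered_def by blast
  then have T: "T > 0" using I finite_I by (simp add: T_def card_gt_0_iff)
  obtain \<rho>' where \<rho>': "0 \<le> \<rho>'" "\<rho>' < 1"
    "\<And>t0 w d a. \<lbrakk>t0 \<ge> 1; trajectory G t0 w; \<forall>a\<in>I. norm (w t0 a) \<le> d; a \<in> I\<rbrakk>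
      \<Longrightarrow> norm (w (t0 + T) a) \<le> \<rho>' * d"
    using trajectory_contraction[OF gr ent] unfolding T_def by metis
  \<comment> \<open>A positive factor, so that its \<open>T\<close>-th root and its inverse make sense.\<close>
  define \<rho> where "\<rho> = max \<rho>' (1 / 2)"
  have \<rho>: "0 < \<rho>" "\<rho> < 1" "\<rho>' \<le> \<rho>" using \<rho>' by (auto simp: \<rho>_def)
  define l where "l = root T \<rho>"
  have l: "0 < l" "l < 1" "l ^ T = \<rho>" using \<rho> T by (auto simp: l_def)
  show ?thesis
  proof (rule exI[of _ "1 / \<rho>"], intro exI[of _ l] conjI allI impI ballI)
    fix t0 w d a k
    assume t0: "t0 \<ge> 1" and tr: "trajectory G t0 w"
      and d: "\<forall>a\<in>I. norm (w t0 a) \<le> d" and a: "a \<in> I"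
    have d0: "d \<ge> 0" using d a norm_ge_zero order_trans by blast
    have gr': "graphs_from (t0 + j) G" for j
      using gr t0 by (simp add: graphs_from_def)
    have tr': "trajectory G (t0 + j) w" for j using tr by (simp add: trajectory_def)
    have windows: "\<forall>a\<in>I. norm (w (t0 + q * T) a) \<le> \<rho> ^ q * d" for q
    proof (induction q)
      case (Suc q)
      have "norm (w (t0 + q * T + T) a) \<le> \<rho>' * (\<rho> ^ q * d)" if "a \<in> I" for a
        using t0 Suc that by (intro \<rho>'(3)[OF _ tr'[of "q * T"]]) auto
      moreover have "\<rho>' * (\<rho> ^ q * d) \<le> \<rho> * (\<rho> ^ q * d)"
        using \<rho> d0 by (intro mult_right_mono) auto
      ultimately have "norm (w (t0 + q * T + T) a) \<le> \<rho> * (\<rho> ^ q * d)" if "a \<in> I" for a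
        using that order_trans by blast
      then show ?case
        by (simp add: algebra_simps)
    qed (use d in simp)
    define q r where "q = k div T" and "r = k mod T"
    have k: "k = q * T + r" by (simp only: q_def r_def div_mult_mod_eq)
    have r: "r < T" using T by (simp add: r_def)
    have "norm (w (t0 + q * T + r) a) \<le> \<rho> ^ q * d"
      by (rule trajectory_norm_le[OF gr'[of "q * T"] tr'[of "q * T"]]) (use windows a in auto)
    also have "\<rho> ^ q * d \<le> 1 / \<rho> * l ^ k * d"
    proof (intro mult_right_mono d0)
      have "l ^ T \<le> l ^ r" using r l by (intro power_decreasing) auto
      then have "\<rho> ^ q * \<rho> \<le> \<rho> ^ q * l ^ r" using \<rho> l by (intro mult_left_mono) auto
      also have "\<dots> = l ^ k" by (simp only: k power_add power_mult mult.commute[of q] l(3))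
      finally show "\<rho> ^ q \<le> 1 / \<rho> * l ^ k" using \<rho>(1) by (simp add: pos_le_divide_eq)
    qed
    finally show "norm (w (t0 + k) a) \<le> 1 / \<rho> * l ^ k * d" by (simp add: k add.assoc)
  qed (use \<rho> l in auto)
qed

end

section \<open>Compositions of graphs\<close>

lemma composition_Cons: "composition (G # Gs) = G O composition Gs"
  by (simp add: composition_def)

text \<open>
  An arc of the composition is a path through the graphs one after another, and a path that ends in
  \<open>E\<close> and starts outside has to cross into \<open>E\<close> somewhere.
\<close>

lemma composition_enters:
  assumes "(j, i) \<in> composition Gs" "i \<in> E" "j \<notin> E"
  shows "\<exists>G\<in>set Gs. \<exists>i'\<in>E. \<exists>j'. j' \<notin> E \<and> (j', i') \<in> G"
  using assms
proof (induction Gs arbitrary: j)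
  case Nil
  then show ?case by (simp add: composition_def)
next
  case (Cons G Gs)
  then obtain p where p: "(j, p) \<in> G" "(p, i) \<in> composition Gs"
    by (auto simp: composition_Cons)
  show ?case
  proof (cases "p \<in> E")
    case True
    then show ?thesis using p Cons.prems by auto
  next
    case False
    then show ?thesis using Cons.IH[OF p(2)] Cons.prems by auto
  qed
qed

lemma composition_backward_closed_pairs:
  assumes closed: "\<And>G i j p q. \<lbrakk>G \<in> Z; (i, j) \<in> E; (p, i) \<in> G; (q, j) \<in> G\<rbrakk> \<Longrightarrow> (p, q) \<in> E"
    and "(i, j) \<in> E" and "set Gs \<subseteq> Z" "(p, i) \<in> composition Gs" "(q, j) \<in> composition Gs"
  shows "(p, q) \<in> E"
  using assms(3-5)
proof (induction Gs arbitrary: p q)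
  case Nil
  then show ?case using assms(2) by (simp add: composition_def)
next
  case (Cons G Gs)
  obtain p' q' where p: "(p, p') \<in> G" "(p', i) \<in> composition Gs"
    and q: "(q, q') \<in> G" "(q', j) \<in> composition Gs"
    using Cons.prems(2,3) by (auto simp: composition_Cons)
  have G: "G \<in> Z" and "set Gs \<subseteq> Z" using Cons.prems(1) by simp_all
  then have "(p', q') \<in> E" using Cons.IH p(2) q(2) by blast
  then show ?case by (rule closed[OF G _ p(1) q(1)])
qed

lemma composition_refl:
  assumes "\<And>G. G \<in> set Gs \<Longrightarrow> (i, i) \<in> G"
  shows "(i, i) \<in> composition Gs"
  using assms
proof (induction Gs)
  case (Cons G Gs)
  have "(i, i) \<in> composition Gs" using Cons by simp
  then show ?case using Cons.prems[of G] by (auto simp: composition_Cons)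
qed (simp add: composition_def)

text \<open>
  Self-arcs allow a path to wait at \<open>j\<close> before and at \<open>i\<close> after the step in which the arc is available.
\<close>

lemma composition_contains:
  assumes "\<And>G. G \<in> set Gs \<Longrightarrow> (i, i) \<in> G" "\<And>G. G \<in> set Gs \<Longrightarrow> (j, j) \<in> G"
    and "G \<in> set Gs" "(j, i) \<in> G"
  shows "(j, i) \<in> composition Gs"
  using assms
proof (induction Gs)
  case (Cons H Hs)
  show ?case
  proof (cases "G = H")
    case True
    have "(i, i) \<in> composition Hs" using Cons.prems by (intro composition_refl) auto
    then show ?thesis using Cons.prems(4) True by (auto simp: composition_Cons)
  next
    case False
    then have "G \<in> set Hs" using Cons.prems(3) by simp
    then have "(j, i) \<in> composition Hs" using Cons.prems by (intro Cons.IH) simp_all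
    moreover have "(j, j) \<in> H" using Cons.prems(2) by simp
    ultimately show ?thesis by (auto simp: composition_Cons)
  qed
qed simp

text \<open>
  Let \<open>v\<close> be a vertex with the fewest ancestors; then all its ancestors are also descendants of it. Its
  ancestors form one of the two sets, and the vertices that \<open>v\<close> does not reach form the other.
\<close>

lemma not_rooted_disjoint_closed_sets:
  assumes "m \<ge> 1" "\<not> rooted m G"
  obtains E F where "E \<noteq> {}" "F \<noteq> {}" "E \<subseteq> {1..m}" "F \<subseteq> {1..m}" "E \<inter> F = {}"
    "\<And>i j. \<lbrakk>i \<in> E; j \<in> {1..m} - E\<rbrakk> \<Longrightarrow> (j, i) \<notin> G"
    "\<And>i j. \<lbrakk>i \<in> F; j \<in> {1..m} - F\<rbrakk> \<Longrightarrow> (j, i) \<notin> G"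
proof -
  define anc where "anc v = {u \<in> {1..m}. (u, v) \<in> G\<^sup>*}" for v
  have "\<exists>v. v \<in> {1..m}" using assms by auto
  then obtain v where v: "v \<in> {1..m}" "\<And>u. u \<in> {1..m} \<Longrightarrow> card (anc v) \<le> card (anc u)"
    using ex_has_least_nat[of "\<lambda>v. v \<in> {1..m}" _ "\<lambda>v. card (anc v)"] by blast
  define F where "F = {u \<in> {1..m}. (v, u) \<notin> G\<^sup>*}"
  have vanc: "v \<in> anc v" using v by (simp add: anc_def)
  show ?thesis
  proof (rule that[of "anc v" F])
    show "anc v \<noteq> {}" using vanc by auto
    show "F \<noteq> {}" using assms(2) v(1) unfolding rooted_def F_def by blast
    show "anc v \<subseteq> {1..m}" "F \<subseteq> {1..m}" by (auto simp: anc_def F_def)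
    show "anc v \<inter> F = {}"
    proof (rule ccontr)
      assume "anc v \<inter> F \<noteq> {}"
      then obtain u where u: "u \<in> {1..m}" "(u, v) \<in> G\<^sup>*" "(v, u) \<notin> G\<^sup>*"
        by (auto simp: anc_def F_def)
      then have "anc u \<subset> anc v" using vanc by (auto simp: anc_def intro: rtrancl_trans)
      then have "card (anc u) < card (anc v)" by (intro psubset_card_mono) (simp add: anc_def)
      then show False using v(2)[OF u(1)] by simp
    qed
    show "(j, i) \<notin> G" if "i \<in> anc v" "j \<in> {1..m} - anc v" for i j
      using that by (auto simp: anc_def intro: converse_rtrancl_into_rtrancl)
    show "(j, i) \<notin> G" if "i \<in> F" "j \<in> {1..m} - F" for i j
      using that by (auto simp: F_def intro: rtrancl_into_rtrancl)
  qed
qed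

text \<open>
  The blocks prescribed by the definition are aligned to multiples of \<open>l\<close>, but any interval of length
  \<open>\<tau> + 2 * l\<close> contains a whole block. This removes the alignment from later arguments.
\<close>

lemma repeatedly_jointly_windows:
  assumes "repeatedly_jointly Q N"
  obtains L where "L \<ge> 1"
    "\<And>s. \<exists>a b. s \<le> a \<and> a \<le> b \<and> b \<le> s + L \<and> Q (composition (map N [a..<b]))"
proof -
  obtain l \<tau> where l: "l \<ge> 1" and Q: "\<And>k. Q (composition (map N [\<tau> + k * l..<\<tau> + (k + 1) * l]))"
    using assms unfolding repeatedly_jointly_def by blast
  show ?thesis
  proof (rule that[of "\<tau> + 2 * l"])
    fix s
    define q where "q = s div l"
    have ql: "q * l \<le> s" by (simp add: q_def)
    have sq: "s < q * l + l"
      using l dividend_less_div_times[of l s] by (simp add: q_def)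
    have e1: "(q + 1) * l = q * l + l" by simp
    have e2: "(q + 1 + 1) * l = q * l + l + l" by simp
    have "s \<le> \<tau> + (q + 1) * l" "\<tau> + (q + 1) * l \<le> \<tau> + (q + 1 + 1) * l"
      "\<tau> + (q + 1 + 1) * l \<le> s + (\<tau> + 2 * l)"
      unfolding e1 e2 using ql sq by linarith+
    then show "\<exists>a b. s \<le> a \<and> a \<le> b \<and> b \<le> s + (\<tau> + 2 * l) \<and> Q (composition (map N [a..<b]))"
      using Q[of "q + 1"] by blast
  qed (use l in simp)
qed

lemma repeatedly_jointlyI:
  assumes "L \<ge> 1" "\<And>s. s \<ge> 1 \<Longrightarrow> Q (composition (map N [s..<s + L]))"
  shows "repeatedly_jointly Q N"
proof -
  have "Q (composition (map N [1 + k * L..<1 + (k + 1) * L]))" for k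
    using assms(2)[of "1 + k * L"] by (simp add: add.commute add.left_commute)
  then show ?thesis
    unfolding repeatedly_jointly_def using assms(1) by (meson order_refl)
qed

section \<open>Orthogonal projections and kernels\<close>

lemma orth_proj_in:
  assumes "subspace S"
  shows "orth_proj S *v x \<in> S"
  using theI'[OF orth_proj_unique[OF assms]] unfolding orth_proj_def by blast

lemma orth_proj_orthogonal:
  assumes "subspace S" "y \<in> S"
  shows "(x - orth_proj S *v x) \<bullet> y = 0"
  using theI'[OF orth_proj_unique[OF assms(1)]] assms(2)
  unfolding orth_proj_def orthogonal_def by blast

lemma orth_proj_eqI:
  assumes S: "subspace S" and u: "u \<in> S" "\<And>y. y \<in> S \<Longrightarrow> (x - u) \<bullet> y = 0"
  shows "orth_proj S *v x = u"
proof -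
  let ?d = "orth_proj S *v x - u"
  have "?d \<in> S" by (rule subspace_diff[OF S orth_proj_in[OF S] u(1)])
  then have "(x - u) \<bullet> ?d = 0" "(x - orth_proj S *v x) \<bullet> ?d = 0"
    using u orth_proj_orthogonal[OF S] by auto
  then have "?d \<bullet> ?d = 0" by (simp add: inner_diff_left)
  then show ?thesis by simp
qed

lemma orth_proj_fixes: "subspace S \<Longrightarrow> x \<in> S \<Longrightarrow> orth_proj S *v x = x"
  by (rule orth_proj_eqI) auto

lemma orth_proj_nested:
  assumes "subspace S" "subspace T" "S \<subseteq> T"
  shows "orth_proj S *v (orth_proj T *v x) = orth_proj S *v x"
proof (rule orth_proj_eqI[symmetric])
  fix y assume y: "y \<in> S"
  then have "(x - orth_proj T *v x) \<bullet> y = 0" "(orth_proj T *v x - orth_proj S *v (orth_proj T *v x)) \<bullet> y = 0"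
    using assms orth_proj_orthogonal by blast+
  then show "(x - orth_proj S *v (orth_proj T *v x)) \<bullet> y = 0"
    by (simp add: inner_diff_left)
qed (use assms orth_proj_in in auto)

lemma inner_orth_proj:
  assumes "subspace S"
  shows "(orth_proj S *v x) \<bullet> x = (orth_proj S *v x) \<bullet> (orth_proj S *v x)"
  using orth_proj_orthogonal[OF assms orth_proj_in[OF assms], of x x]
  by (metis inner_commute inner_diff_left right_minus_eq)

lemma mat_vec_eq_iff: "mat_vec B x = mat_vec B z \<longleftrightarrow> x - z \<in> ker B"
  by (auto simp: ker_def mat_vec_def map_replicate_const[symmetric] inner_diff_right)

section \<open>Sequences with geometric increments\<close>

lemma geometric_increments_converge:
  fixes f :: "nat \<Rightarrow> 'v::banach"
  assumes l: "0 \<le> l" "l < 1" and inc: "\<And>n. norm (f (Suc n) - f n) \<le> B * l ^ n"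
  obtains z where "f \<longlonglongrightarrow> z" "\<And>n. norm (f n - z) \<le> B * l ^ n / (1 - l)"
proof -
  have geo: "summable (\<lambda>n. B * l ^ n)"
    using l by (simp add: summable_geometric)
  have sumn: "summable (\<lambda>n. norm (f (Suc n) - f n))"
    by (rule summable_comparison_test'[OF geo, of 0]) (simp add: inc)
  then have "summable (\<lambda>n. f (Suc n) - f n)" by (rule summable_norm_cancel)
  then have "convergent (\<lambda>n. \<Sum>k<n. f (Suc k) - f k)"
    by (simp add: summable_iff_convergent)
  then have "convergent (\<lambda>n. f n - f 0)" by (simp only: sum_lessThan_telescope)
  then obtain y where "(\<lambda>n. f n - f 0) \<longlonglongrightarrow> y" using convergentD by blast
  then have "(\<lambda>n. (f n - f 0) + f 0) \<longlonglongrightarrow> y + f 0"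
    by (rule tendsto_add[OF _ tendsto_const])
  then have lim: "f \<longlonglongrightarrow> y + f 0" by (simp only: diff_add_cancel)
  show ?thesis
  proof (rule that[OF lim])
    fix n
    have "norm (f (n + k) - f n) \<le> B * l ^ n / (1 - l)" for k
    proof -
      have "B \<ge> 0" using order_trans[OF norm_ge_zero inc[of 0]] by simp
      have "norm (f (n + k) - f n) = norm (\<Sum>j<k. f (n + Suc j) - f (n + j))"
        using sum_lessThan_telescope[of "\<lambda>j. f (n + j)" k] by simp
      also have "\<dots> \<le> (\<Sum>j<k. B * l ^ n * l ^ j)"
        using inc[of "n + j" for j] by (intro sum_norm_le) (simp add: power_add mult.assoc)
      also have "\<dots> = B * l ^ n * ((1 - l ^ k) / (1 - l))"
        using l by (simp add: sum_gp_strict flip: sum_distrib_left)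
      also have "\<dots> \<le> B * l ^ n * (1 / (1 - l))"
        using l \<open>B \<ge> 0\<close> by (intro mult_left_mono divide_right_mono) auto
      finally show ?thesis by simp
    qed
    moreover have "(\<lambda>k. norm (f (n + k) - f n)) \<longlonglongrightarrow> norm (y + f 0 - f n)"
      using LIMSEQ_ignore_initial_segment[OF lim, of n]
      by (intro tendsto_intros) (simp add: add.commute)
    ultimately have "norm (y + f 0 - f n) \<le> B * l ^ n / (1 - l)"
      by (intro LIMSEQ_le_const2) auto
    then show "norm (f n - (y + f 0)) \<le> B * l ^ n / (1 - l)"
      by (simp add: norm_minus_commute)
  qed
qed

section \<open>Agents on a sequence of graphs with self-arcs\<close>

locale agents =
  fixes m :: nat and A :: "nat \<Rightarrow> ('n::finite) row_matrix" and N :: "nat \<Rightarrow> (nat \<times> nat) set"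
  assumes m: "m \<ge> 1"
    and N_sub: "\<And>t. t \<ge> 1 \<Longrightarrow> N t \<subseteq> {1..m} \<times> {1..m}"
    and N_self: "\<And>t i. t \<ge> 1 \<Longrightarrow> i \<in> {1..m} \<Longrightarrow> (i, i) \<in> N t"
begin

abbreviation "V \<equiv> {1..m}"

definition common_ker :: "(real ^ 'n) set" where
  "common_ker = (\<Inter>i\<in>V. ker (A i))"

lemma subspace_common_ker: "subspace common_ker"
  unfolding common_ker_def by (intro subspace_Inter) (auto simp: subspace_ker)

lemma common_ker_subset: "i \<in> V \<Longrightarrow> common_ker \<subseteq> ker (A i)"
  by (auto simp: common_ker_def)

lemma max_dist_le_iff: "max_dist m y z \<le> d \<longleftrightarrow> (\<forall>i\<in>V. norm (y i - z) \<le> d)"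
  unfolding max_dist_def using m by (subst Max_le_iff) auto

lemma norm_le_max_dist: "i \<in> V \<Longrightarrow> norm (y i - z) \<le> max_dist m y z"
  using max_dist_le_iff by blast

lemma neighbors_N:
  assumes "t \<ge> 1" "i \<in> V"
  shows "finite (neighbors (N t) i)" "neighbors (N t) i \<subseteq> V" "i \<in> neighbors (N t) i"
proof -
  show "neighbors (N t) i \<subseteq> V" "i \<in> neighbors (N t) i"
    using N_sub[OF assms(1)] N_self[OF assms] by (auto simp: neighbors_def)
  then show "finite (neighbors (N t) i)" using finite_subset[OF _ finite_atLeastAtMost] by blast
qed

section \<open>Closed sets as obstructions to uniform convergence\<close>

lemma trajectory_exists:
  obtains x where "\<And>i. x i t0 = y i" "trajectory_from t0 m A N x"
proof -
  define X where "X = rec_nat y (\<lambda>k Y i. let mi = real (card (neighbors (N (t0 + k)) i)) in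
         Y i - (1 / mi) *\<^sub>R
             (orth_proj (ker (A i)) *v (mi *\<^sub>R Y i - (\<Sum>j\<in>neighbors (N (t0 + k)) i. Y j))))"
  show ?thesis
  proof (rule that[of "\<lambda>i t. X (t - t0) i"])
    show "X (t0 - t0) i = y i" for i by (simp add: X_def)
    show "trajectory_from t0 m A N (\<lambda>i t. X (t - t0) i)"
      unfolding trajectory_from_def by (auto simp: Suc_diff_le X_def)
  qed
qed

text \<open>
  An agent of \<open>E\<close> averages only over agents of \<open>E\<close>, all at the same point, so its correction term
  vanishes.
\<close>

lemma closed_set_frozen:
  assumes t0: "t0 \<ge> 1" and x: "trajectory_from t0 m A N x"
    and E: "E \<subseteq> V" "\<And>i. i \<in> E \<Longrightarrow> x i t0 = p"
    and closed: "\<And>t i j. \<lbrakk>t \<in> {t0..<t0 + k}; i \<in> E; j \<in> V - E\<rbrakk> \<Longrightarrow> (j, i) \<notin> N t"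
    and i: "i \<in> E"
  shows "x i (t0 + k) = p"
  using closed i
proof (induction k arbitrary: i)
  case (Suc k)
  let ?B = "neighbors (N (t0 + k)) i"
  have i: "i \<in> V" using Suc.prems E by blast
  have "?B \<subseteq> E"
  proof
    fix j assume j: "j \<in> ?B"
    then have "j \<in> V" using neighbors_N(2)[of "t0 + k" i] i t0 by auto
    then show "j \<in> E"
      using Suc.prems(1)[of "t0 + k" i j] Suc.prems(2) j by (auto simp: neighbors_def)
  qed
  moreover have IH: "x j (t0 + k) = p" if "j \<in> E" for j
    using Suc.prems that by (intro Suc.IH) auto
  ultimately have "(\<Sum>j\<in>?B. x j (t0 + k)) = (\<Sum>j\<in>?B. p)"
    by (intro sum.cong) auto
  then have "(\<Sum>j\<in>?B. x j (t0 + k)) = real (card ?B) *\<^sub>R p"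
    by (simp only: sum_constant_scaleR)
  moreover have "x i (t0 + Suc k) = x i (t0 + k) - (1 / real (card ?B)) *\<^sub>R
     (orth_proj (ker (A i)) *v (real (card ?B) *\<^sub>R x i (t0 + k) - (\<Sum>j\<in>?B. x j (t0 + k))))"
    using x i by (simp add: trajectory_from_def Let_def)
  ultimately show ?case
    using IH[OF Suc.prems(2)] by simp
qed (use E in simp)

text \<open>
  Over a window with \<open>c * \<mu> ^ L < 1\<close> the maximal distance to the limit has to drop unless it is
  already zero. The necessity proof exhibits initial states for which it does not drop.
\<close>

lemma window_contraction:
  assumes "converges_at_rate m A b N \<mu>" "0 \<le> \<mu>" "\<mu> < 1"
  shows "\<exists>L\<ge>1. \<forall>t0\<ge>1. \<forall>y. (\<forall>i\<in>V. mat_vec (A i) (y i) = b i) \<longrightarrow>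
      (\<exists>x z. (\<forall>i. x i t0 = y i) \<and> trajectory_from t0 m A N x \<and> mat_vec (stack m A) z = stack m b \<and>
        (max_dist m y z \<le> max_dist m (\<lambda>i. x i (t0 + L)) z \<longrightarrow> (\<forall>i\<in>V. y i = z)))"
proof -
  obtain c where c: "c > 0" and conv: "\<forall>t0\<ge>1. \<forall>x. trajectory_from t0 m A N x \<and>
      (\<forall>i\<in>V. mat_vec (A i) (x i t0) = b i) \<longrightarrow>
        (\<exists>z. mat_vec (stack m A) z = stack m b \<and> (\<forall>t\<ge>t0. max_dist m (\<lambda>i. x i t) z
                     \<le> c * \<mu> ^ (t - t0) * max_dist m (\<lambda>i. x i t0) z))"
    using assms(1) unfolding converges_at_rate_def by blast
  obtain k where k: "\<mu> ^ k < 1 / c"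
    using real_arch_pow_inv[of "1 / c" \<mu>] assms c by auto
  define L where "L = Suc k"
  have "\<mu> ^ L \<le> \<mu> ^ k" using assms by (simp add: L_def mult_left_le_one_le)
  then have "c * \<mu> ^ L \<le> c * \<mu> ^ k" using c by (intro mult_left_mono) auto
  also have "\<dots> < 1" using k c by (simp add: field_simps)
  finally have cL: "c * \<mu> ^ L < 1" .
  show ?thesis
  proof (intro exI[of _ L] conjI allI impI)
    fix t0 :: nat and y assume t0: "t0 \<ge> 1" and y: "\<forall>i\<in>V. mat_vec (A i) (y i) = b i"
    obtain x where x: "\<And>i. x i t0 = y i" "trajectory_from t0 m A N x"
      using trajectory_exists by blast
    moreover have "\<forall>i\<in>V. mat_vec (A i) (x i t0) = b i" using x y by simp
    ultimately obtain z where z: "mat_vec (stack m A) z = stack m b"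
      and zt: "\<forall>t\<ge>t0. max_dist m (\<lambda>i. x i t) z
        \<le> c * \<mu> ^ (t - t0) * max_dist m (\<lambda>i. x i t0) z"
      using conv t0 by blast
    have zL: "max_dist m (\<lambda>i. x i (t0 + L)) z \<le> c * \<mu> ^ L * max_dist m y z"
      using zt[rule_format, of "t0 + L"] x(1) by simp
    have "y i = z" if "max_dist m y z \<le> max_dist m (\<lambda>i. x i (t0 + L)) z" "i \<in> V" for i
    proof -
      have "(1 - c * \<mu> ^ L) * max_dist m y z \<le> 0" using that zL by (simp add: algebra_simps)
      then have "max_dist m y z \<le> 0" using cL by (simp add: mult_le_0_iff)
      then have "norm (y i - z) \<le> 0" using norm_le_max_dist[OF that(2), of y z] by linarith
      then show ?thesis by simp
    qed
    then show "\<exists>x z. (\<forall>i. x i t0 = y i) \<and> trajectory_from t0 m A N x \<and>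
        mat_vec (stack m A) z = stack m b \<and>
        (max_dist m y z \<le> max_dist m (\<lambda>i. x i (t0 + L)) z \<longrightarrow> (\<forall>i\<in>V. y i = z))"
      using x z by blast
  qed (simp add: L_def)
qed

text \<open>
  Closedness under the composed graph passes to the single graphs, because every arc of theirs
  is an arc of the composition.
\<close>

lemma composition_closed_imp_closed:
  assumes "t0 \<ge> 1" "E \<subseteq> V"
    and "\<And>i j. \<lbrakk>i \<in> E; j \<in> V - E\<rbrakk> \<Longrightarrow> (j, i) \<notin> composition (map N [t0..<t0 + L])"
    and "t \<in> {t0..<t0 + L}" "i \<in> E" "j \<in> V - E"
  shows "(j, i) \<notin> N t"
proof (rule notI)
  assume "(j, i) \<in> N t"
  then have "(j, i) \<in> composition (map N [t0..<t0 + L])"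
    using assms(1,2,4-6) N_self by (intro composition_contains[where G = "N t"]) auto
  then show False using assms(3)[OF assms(5,6)] by contradiction
qed

lemma necessity:
  assumes conv: "converges_at_rate m A b N \<mu>" "0 \<le> \<mu>" "\<mu> < 1"
    and sol: "\<And>z. mat_vec (stack m A) z = stack m b \<longleftrightarrow> (\<forall>i\<in>V. mat_vec (A i) z = b i)"
    and z0: "mat_vec (stack m A) z0 = stack m b" and v0: "v0 \<in> common_ker" "v0 \<noteq> 0"
  shows "repeatedly_jointly (rooted m) N \<and> repeatedly_jointly (D_connected m A) N"
proof -
  obtain L where L: "L \<ge> 1" and contr:
    "\<forall>t0\<ge>1. \<forall>y. (\<forall>i\<in>V. mat_vec (A i) (y i) = b i) \<longrightarrow>
      (\<exists>x z. (\<forall>i. x i t0 = y i) \<and> trajectory_from t0 m A N x \<and> mat_vec (stack m A) z = stack m b \<and>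
        (max_dist m y z \<le> max_dist m (\<lambda>i. x i (t0 + L)) z \<longrightarrow> (\<forall>i\<in>V. y i = z)))"
    using window_contraction[OF conv] by blast
  have sol_iff: "mat_vec (A i) y = b i \<longleftrightarrow> y - z0 \<in> ker (A i)" if "i \<in> V" for i y
    using sol[of z0] z0 that mat_vec_eq_iff[of "A i" y z0] by simp
  have zero_ker: "0 \<in> ker (A i)" for i
    by (rule subspace_0[OF subspace_ker])
  have in_common: "z - z0 \<in> common_ker" if "mat_vec (stack m A) z = stack m b" for z
    using sol[of z] that sol_iff[of _ z] unfolding common_ker_def by blast
  have "rooted m (composition (map N [t0..<t0 + L]))" if t0: "t0 \<ge> 1" for t0
  proof (rule ccontr)
    assume "\<not> ?thesis"
    then obtain E F where E: "E \<noteq> {}" "E \<subseteq> V" and F: "F \<noteq> {}" "F \<subseteq> V" and EF: "E \<inter> F = {}"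
      and Ec: "\<And>i j. \<lbrakk>i \<in> E; j \<in> V - E\<rbrakk> \<Longrightarrow> (j, i) \<notin> composition (map N [t0..<t0 + L])"
      and Fc: "\<And>i j. \<lbrakk>i \<in> F; j \<in> V - F\<rbrakk> \<Longrightarrow> (j, i) \<notin> composition (map N [t0..<t0 + L])"
      using not_rooted_disjoint_closed_sets[OF m] by metis
    \<comment> \<open>\<open>E\<close> and \<open>F\<close> hold two different solutions, at least one of which is at maximal distance
      from the limit; both persist through the window.\<close>
    define y where "y i = (if i \<in> E then z0 + v0 else z0)" for i
    have "\<forall>i\<in>V. mat_vec (A i) (y i) = b i"
      using v0(1) zero_ker by (simp add: sol_iff y_def common_ker_def)
    with contr t0 obtain x z where x: "\<And>i. x i t0 = y i" "trajectory_from t0 m A N x"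
      and le: "max_dist m y z \<le> max_dist m (\<lambda>i. x i (t0 + L)) z \<Longrightarrow> \<forall>i\<in>V. y i = z"
      by blast
    obtain e f where ef: "e \<in> E" "f \<in> F" using E F by auto
    have "x e (t0 + L) = z0 + v0"
      using composition_closed_imp_closed[OF t0 E(2) Ec] ef x
      by (intro closed_set_frozen[OF t0 x(2) E(2)]) (auto simp: y_def)
    moreover have "x f (t0 + L) = z0"
      using composition_closed_imp_closed[OF t0 F(2) Fc] ef x EF
      by (intro closed_set_frozen[OF t0 x(2) F(2)]) (auto simp: y_def)
    ultimately have "norm (z0 + v0 - z) \<le> max_dist m (\<lambda>i. x i (t0 + L)) z"
      "norm (z0 - z) \<le> max_dist m (\<lambda>i. x i (t0 + L)) z"
      using norm_le_max_dist[of e "\<lambda>i. x i (t0 + L)" z]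
        norm_le_max_dist[of f "\<lambda>i. x i (t0 + L)" z] ef E F by auto
    then have "max_dist m y z \<le> max_dist m (\<lambda>i. x i (t0 + L)) z"
      by (simp add: max_dist_le_iff y_def)
    then have "y e = z" "y f = z" using le ef E F by auto
    moreover have "f \<notin> E" using ef EF by blast
    ultimately show False using v0(2) ef(1) by (simp add: y_def)
  qed
  moreover have "D_connected m A (composition (map N [t0..<t0 + L]))" if t0: "t0 \<ge> 1" for t0
  proof (rule ccontr)
    assume "\<not> ?thesis"
    then obtain E where pp: "partially_populated m A E"
      and Ec: "\<And>i j. \<lbrakk>i \<in> E; j \<in> V - E\<rbrakk> \<Longrightarrow> (j, i) \<notin> composition (map N [t0..<t0 + L])"
      unfolding D_connected_def by blast
    have E: "E \<noteq> {}" "E \<subseteq> V" using pp by (auto simp: partially_populated_def)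
    obtain u where u: "u \<notin> common_ker" "\<And>i. i \<in> E \<Longrightarrow> u \<in> ker (A i)"
      using pp by (auto simp: partially_populated_def common_ker_def)
    \<comment> \<open>Removing the component in the common kernel makes \<open>z0 + v\<close> at least as far as \<open>z0\<close> from
      every solution, so that the frozen agents realise the maximal distance.\<close>
    define v where "v = u - orth_proj common_ker *v u"
    have pu: "orth_proj common_ker *v u \<in> common_ker"
      by (rule orth_proj_in[OF subspace_common_ker])
    have vE: "v \<in> ker (A i)" if "i \<in> E" for i
    proof -
      have "i \<in> V" using that E by blast
      then have "orth_proj common_ker *v u \<in> ker (A i)"
        using pu common_ker_subset by blast
      then show ?thesis
        unfolding v_def by (intro subspace_diff subspace_ker u(2)[OF that])
    qed
    have orth: "v \<bullet> s = 0" if "s \<in> common_ker" for s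
      unfolding v_def by (rule orth_proj_orthogonal[OF subspace_common_ker that])
    have v: "v \<notin> common_ker"
      using u(1) pu subspace_add[OF subspace_common_ker, of v "orth_proj common_ker *v u"]
      by (auto simp: v_def)
    define y where "y i = (if i \<in> E then z0 + v else z0)" for i
    have "\<forall>i\<in>V. mat_vec (A i) (y i) = b i"
      using vE zero_ker by (simp add: sol_iff y_def)
    with contr t0 obtain x z where x: "\<And>i. x i t0 = y i" "trajectory_from t0 m A N x"
      and z: "mat_vec (stack m A) z = stack m b"
      and le: "max_dist m y z \<le> max_dist m (\<lambda>i. x i (t0 + L)) z \<Longrightarrow> \<forall>i\<in>V. y i = z"
      by blast
    obtain e where e: "e \<in> E" using E by auto
    have "x e (t0 + L) = z0 + v"
      using composition_closed_imp_closed[OF t0 E(2) Ec] e x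
      by (intro closed_set_frozen[OF t0 x(2) E(2)]) (auto simp: y_def)
    then have far: "norm (z0 + v - z) \<le> max_dist m (\<lambda>i. x i (t0 + L)) z"
      using norm_le_max_dist[of e "\<lambda>i. x i (t0 + L)" z] e E by auto
    define s where "s = z - z0"
    have s: "s \<in> common_ker" using in_common z by (simp add: s_def)
    have "(norm s)\<^sup>2 \<le> (norm (v - s))\<^sup>2"
      using orth[OF s] by (simp add: power2_norm_eq_inner inner_diff inner_commute)
    then have "norm (z0 - z) \<le> norm (z0 + v - z)"
      by (simp add: s_def norm_minus_commute power2_le_iff_abs_le algebra_simps)
    then have "max_dist m y z \<le> max_dist m (\<lambda>i. x i (t0 + L)) z"
      using far by (simp add: max_dist_le_iff y_def)
    then have "y e = z" using le e E by auto
    then have "v = s" using e by (auto simp: y_def s_def)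
    then show False using v s by simp
  qed
  ultimately show ?thesis
    using repeatedly_jointlyI[OF L] by blast
qed

section \<open>Residual and disagreement\<close>

abbreviation "Q x \<equiv> orth_proj common_ker *v x"

abbreviation "R i x \<equiv> orth_proj (ker (A i)) *v x"

lemma R_Q: "i \<in> V \<Longrightarrow> R i (Q x) = Q x"
  using orth_proj_in[OF subspace_common_ker] common_ker_subset
  by (intro orth_proj_fixes subspace_ker) blast

lemma Q_R: "i \<in> V \<Longrightarrow> Q (R i x) = Q x"
  by (intro orth_proj_nested subspace_common_ker subspace_ker common_ker_subset)

lemma Q_Q: "Q (Q x) = Q x"
  by (intro orth_proj_fixes subspace_common_ker orth_proj_in)

text \<open>
  On \<open>V\<close> this is the orthogonal projection onto the part of \<open>ker (A i)\<close> that is orthogonal to the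
  common kernel; the value \<open>0\<close> elsewhere only makes it a projection for every index.
\<close>

definition residual :: "nat \<Rightarrow> real ^ 'n \<Rightarrow> real ^ 'n" where
  "residual i x = (if i \<in> V then R i x - Q x else 0)"

lemma residual_eq: "i \<in> V \<Longrightarrow> residual i x = R i x - Q x"
  unfolding residual_def by (rule if_P)

lemma residual_outside: "i \<notin> V \<Longrightarrow> residual i x = 0"
  unfolding residual_def by (rule if_not_P)

lemma linear_residual: "linear (residual i)"
proof (cases "i \<in> V")
  case True
  then have "residual i = (\<lambda>x. R i x - Q x)" by (intro ext residual_eq)
  then show ?thesis by (simp add: linear_compose_sub)
next
  case False
  then have "residual i = (\<lambda>x. 0)" by (intro ext residual_outside)
  then show ?thesis by (simp add: linear_zero)
qed

lemma inner_residual: "residual i x \<bullet> x = residual i x \<bullet> residual i x"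
proof (cases "i \<in> V")
  case True
  have "(x - R i x) \<bullet> Q x = 0"
    using common_ker_subset[OF True] orth_proj_in[OF subspace_common_ker]
    by (intro orth_proj_orthogonal subspace_ker) blast
  moreover have "R i x \<bullet> x = R i x \<bullet> R i x" "Q x \<bullet> x = Q x \<bullet> Q x"
    by (simp_all add: inner_orth_proj subspace_ker subspace_common_ker)
  ultimately show ?thesis
    by (simp add: residual_eq[OF True] inner_diff inner_commute)
qed (simp add: residual_outside)

interpretation residual: projected_averaging V residual
  by (rule projected_averaging.intro) (rule finite_atLeastAtMost linear_residual inner_residual)+

text \<open>
  A nonzero common fixed vector of the residual maps on \<open>E\<close> lies in \<open>ker (A i)\<close> for all \<open>i \<in> E\<close> and is
  orthogonal to the common kernel, so it witnesses that \<open>E\<close> is partially populated.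
\<close>

lemma residual_repeatedly_entered:
  assumes "repeatedly_jointly (D_connected m A) N"
  obtains L where "residual.repeatedly_entered 1 L N"
proof -
  obtain L where L: "L \<ge> 1" and win: "\<And>s. \<exists>a b. s \<le> a \<and> a \<le> b \<and> b \<le> s + L \<and>
      D_connected m A (composition (map N [a..<b]))"
    using repeatedly_jointly_windows[OF assms] by blast
  have "residual.entered N {s..<s + L} E"
    if s: "s \<ge> 1" and E: "E \<subseteq> V" "E \<noteq> {}" and u: "u \<noteq> 0" "\<forall>i\<in>E. residual i u = u" for s E u
  proof -
    have "Q u = 0 \<and> u \<in> ker (A i)" if "i \<in> E" for i
    proof -
      have i: "i \<in> V" using that E by blast
      have "residual i u = u" using u(2) that by blast
      then have eq: "R i u - Q u = u" by (simp only: residual_eq[OF i])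
      have "Q u = Q (R i u - Q u)" using eq by simp
      also have "\<dots> = 0" by (simp add: matrix_vector_mult_diff_distrib Q_R[OF i] Q_Q)
      finally have "Q u = 0" .
      moreover from this have "R i u = u" using eq by simp
      ultimately show ?thesis using orth_proj_in[OF subspace_ker, of "A i" u] by simp
    qed
    then have Q: "Q u = 0" and uE: "\<And>i. i \<in> E \<Longrightarrow> u \<in> ker (A i)" using E by blast+
    have "u \<notin> common_ker"
      using Q u(1) orth_proj_fixes[OF subspace_common_ker, of u] by auto
    then have "partially_populated m A E"
      using E uE unfolding partially_populated_def common_ker_def by blast
    moreover obtain a b where ab: "s \<le> a" "b \<le> s + L" "D_connected m A (composition (map N [a..<b]))"
      using win by blast
    ultimately obtain i j where "i \<in> E" "j \<notin> E" "(j, i) \<in> composition (map N [a..<b])"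
      unfolding D_connected_def by blast
    then obtain G i' j' where G: "G \<in> set (map N [a..<b])" "i' \<in> E" "j' \<notin> E" "(j', i') \<in> G"
      using composition_enters by metis
    then obtain t where t: "t \<in> {a..<b}" "G = N t" by auto
    moreover have "j' \<in> V" using N_sub[of t] G(4) t ab(1) s by auto
    ultimately show ?thesis
      using G ab unfolding residual.entered_def by (intro bexI[of _ t] bexI[of _ i'] bexI[of _ j']) auto
  qed
  then have "residual.repeatedly_entered 1 L N"
    unfolding residual.repeatedly_entered_def using L by blast
  then show ?thesis by (rule that)
qed

definition pair_graph :: "(nat \<times> nat) set \<Rightarrow> ((nat \<times> nat) \<times> nat \<times> nat) set" where
  "pair_graph G = {((p, q), (i, j)). (p, i) \<in> G \<and> (q, j) \<in> G}"

text \<open>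
  The difference of an agent's state with itself is always zero. Building this into the maps removes all
  sets meeting the diagonal from the hypothesis of the stability theorem, and leaves exactly the sets
  to which rootedness applies.
\<close>

definition off_diagonal :: "nat \<times> nat \<Rightarrow> real ^ 'n \<Rightarrow> real ^ 'n" where
  "off_diagonal a x = (if fst a = snd a then 0 else x)"

interpretation disagreement: projected_averaging "V \<times> V" off_diagonal
proof (rule projected_averaging.intro)
  show "linear (off_diagonal a)" for a
  proof (cases "fst a = snd a")
    case True
    then have "off_diagonal a = (\<lambda>x. 0)" by (simp add: off_diagonal_def fun_eq_iff)
    then show ?thesis by (simp add: linear_zero)
  next
    case False
    then have "off_diagonal a = (\<lambda>x. x)" by (simp add: off_diagonal_def fun_eq_iff)
    then show ?thesis by (simp add: linear_ident)
  qed
qed (auto simp: off_diagonal_def)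

text \<open>
  Suppose no arc enters a set \<open>E\<close> of pairs off the diagonal. Then \<open>E\<close> is closed under going back along
  arcs in both coordinates. Self-arcs allow moving one coordinate at a time, so from \<open>(i, j)\<close> one gets
  back to \<open>(r, j)\<close> and on to \<open>(r, r)\<close> for a root \<open>r\<close>, which lies on the diagonal.
\<close>

lemma disagreement_repeatedly_entered:
  assumes "repeatedly_jointly (rooted m) N"
  obtains L where "disagreement.repeatedly_entered 1 L (\<lambda>t. pair_graph (N t))"
proof -
  obtain L where L: "L \<ge> 1" and win: "\<And>s. \<exists>a b. s \<le> a \<and> a \<le> b \<and> b \<le> s + L \<and>
      rooted m (composition (map N [a..<b]))"
    using repeatedly_jointly_windows[OF assms] by blast
  have "disagreement.entered (\<lambda>t. pair_graph (N t)) {s..<s + L} E"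
    if s: "s \<ge> 1" and E: "E \<subseteq> V \<times> V" "E \<noteq> {}"
      and u: "u \<noteq> 0" "\<forall>a\<in>E. off_diagonal a u = u" for s E u
  proof (rule ccontr)
    assume not: "\<not> ?thesis"
    obtain a b where ab: "s \<le> a" "b \<le> s + L" and root: "rooted m (composition (map N [a..<b]))"
      using win by blast
    let ?G = "composition (map N [a..<b])"
    have closed_N: "(p, q) \<in> E" if G: "G \<in> N ` {a..<b}" and arcs: "(i, j) \<in> E" "(p, i) \<in> G" "(q, j) \<in> G"
      for G i j p q
    proof (rule ccontr)
      assume pq: "(p, q) \<notin> E"
      obtain t where t: "t \<in> {a..<b}" "G = N t" using G by blast
      then have "(p, q) \<in> V \<times> V" using N_sub[of t] arcs s ab(1) by auto
      moreover have "((p, q), (i, j)) \<in> pair_graph (N t)" using arcs t by (simp add: pair_graph_def)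
      moreover have "t \<in> {s..<s + L}" using t ab by simp
      ultimately show False using not arcs(1) pq unfolding disagreement.entered_def by blast
    qed
    have closed: "(p, q) \<in> E" if "(i, j) \<in> E" "(p, i) \<in> ?G" "(q, j) \<in> ?G" for i j p q
      by (rule composition_backward_closed_pairs[of "N ` {a..<b}", OF closed_N that(1) _ that(2,3)])
        simp_all
    have self: "(i, i) \<in> ?G" if "i \<in> V" for i
      using N_self that s ab(1) by (intro composition_refl) auto
    have left: "(p, j) \<in> E" if "(p, i) \<in> ?G\<^sup>*" "(i, j) \<in> E" for i j p
      using that(1)
    proof (induction rule: converse_rtrancl_induct)
      case base
      show ?case by (rule that(2))
    next
      case (step p p')
      have "j \<in> V" using that(2) E by blast
      then show ?case using closed[OF step(3,1)] self by blast
    qed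
    have right: "(i, q) \<in> E" if "(q, j) \<in> ?G\<^sup>*" "(i, j) \<in> E" for i j q
      using that(1)
    proof (induction rule: converse_rtrancl_induct)
      case base
      show ?case by (rule that(2))
    next
      case (step q q')
      have "i \<in> V" using that(2) E by blast
      then show ?case using closed[OF step(3) _ step(1)] self by blast
    qed
    obtain r where r: "\<And>v. v \<in> V \<Longrightarrow> (r, v) \<in> ?G\<^sup>*" using root unfolding rooted_def by blast
    obtain i j where ij: "(i, j) \<in> E" using E(2) by auto
    then have "i \<in> V" "j \<in> V" using E(1) by blast+
    then have "(r, r) \<in> E" using left[OF r ij] right[OF r] by blast
    then have "off_diagonal (r, r) u = u" using u(2) by blast
    then show False using u(1) by (simp add: off_diagonal_def)
  qed
  then have "disagreement.repeatedly_entered 1 L (\<lambda>t. pair_graph (N t))"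
    unfolding disagreement.repeatedly_entered_def using L by blast
  then show ?thesis by (rule that)
qed

lemma preds_eq_neighbors: "preds = neighbors"
  by (simp add: fun_eq_iff preds_def neighbors_def)

lemma preds_N:
  assumes "t \<ge> 1" "i \<in> V"
  shows "finite (preds (N t) i)" "preds (N t) i \<noteq> {}" "preds (N t) i \<subseteq> V"
  unfolding preds_eq_neighbors using neighbors_N[OF assms] by blast+

lemma preds_pair_graph: "preds (pair_graph G) (i, j) = preds G i \<times> preds G j"
  by (auto simp: preds_def pair_graph_def)

lemma graphs_from_N: "residual.graphs_from 1 N"
  unfolding residual.graphs_from_def residual.graph_def using N_sub N_self by blast

lemma graphs_from_pair_graph: "disagreement.graphs_from 1 (\<lambda>t. pair_graph (N t))"
  unfolding disagreement.graphs_from_def disagreement.graph_def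
  using N_sub N_self by (fastforce simp: pair_graph_def)

text \<open>
  Membership of the deviation in \<open>ker (A i)\<close> is what cancels the agent's own old state and leaves the
  projected average.
\<close>

lemma centered_step:
  assumes t: "t \<ge> t0" "t0 \<ge> 1" and x: "trajectory_from t0 m A N x" and i: "i \<in> V"
    and ker: "x i t - z0 \<in> ker (A i)"
  shows "x i (Suc t) - z0 = R i (mean (\<lambda>j. x j t - z0) (preds (N t) i))"
proof -
  let ?B = "neighbors (N t) i"
  let ?c = "real (card ?B)"
  let ?S = "\<Sum>j\<in>?B. x j t - z0"
  have c: "?c \<noteq> 0" using neighbors_N[of t i] t i by auto
  have "(\<Sum>j\<in>?B. x j t) = ?S + ?c *\<^sub>R z0"
    by (simp add: sum_subtractf sum_constant_scaleR del: sum_constant)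
  then have "?c *\<^sub>R x i t - (\<Sum>j\<in>?B. x j t) = ?c *\<^sub>R (x i t - z0) - ?S"
    by (simp add: scaleR_diff_right)
  then have "R i (?c *\<^sub>R x i t - (\<Sum>j\<in>?B. x j t)) = ?c *\<^sub>R (x i t - z0) - R i ?S"
    using orth_proj_fixes[OF subspace_ker ker]
    by (simp add: linear_diff[OF matrix_vector_mul_linear] linear_scale[OF matrix_vector_mul_linear])
  then have "x i (Suc t) = x i t - (1 / ?c) *\<^sub>R (?c *\<^sub>R (x i t - z0) - R i ?S)"
    using x t i by (simp add: trajectory_from_def Let_def)
  also have "\<dots> = z0 + (1 / ?c) *\<^sub>R R i ?S"
    using c by (simp add: scaleR_diff_right)
  finally show ?thesis
    by (simp add: mean_def preds_eq_neighbors linear_scale[OF matrix_vector_mul_linear])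
qed

text \<open>
  The common limit is \<open>z0\<close> plus the limit of the common-kernel part of agent 1, whose increments are
  averages of disagreements and so decay geometrically. These estimates are made in terms of the
  initial disagreement \<open>D\<close>, because the limit does not exist yet; afterwards \<open>D\<close> is at most twice the
  initial distance \<open>M\<close> to the limit.
\<close>

lemma sufficiency:
  assumes root: "repeatedly_jointly (rooted m) N" and conn: "repeatedly_jointly (D_connected m A) N"
    and sol: "\<And>z. mat_vec (stack m A) z = stack m b \<longleftrightarrow> (\<forall>i\<in>V. mat_vec (A i) z = b i)"
    and z0: "mat_vec (stack m A) z0 = stack m b"
  shows "\<exists>\<mu>. 0 \<le> \<mu> \<and> \<mu> < 1 \<and> converges_at_rate m A b N \<mu>"
proof -
  have V: "V \<noteq> {}" "1 \<in> V" using m by auto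
  obtain L1 where "residual.repeatedly_entered 1 L1 N"
    by (rule residual_repeatedly_entered[OF conn])
  from residual.exponential_stability[OF graphs_from_N this V(1)]
  obtain C1 l1 where C1: "C1 > 0" "0 < l1" "l1 < 1"
    and decay1: "\<forall>t0\<ge>1. \<forall>w d. residual.trajectory N t0 w \<longrightarrow>
      (\<forall>a\<in>V. norm (w t0 a) \<le> d) \<longrightarrow> (\<forall>k. \<forall>a\<in>V. norm (w (t0 + k) a) \<le> C1 * l1 ^ k * d)"
    by blast
  obtain L2 where L2: "disagreement.repeatedly_entered 1 L2 (\<lambda>t. pair_graph (N t))"
    by (rule disagreement_repeatedly_entered[OF root])
  have "V \<times> V \<noteq> {}" using V by blast
  from disagreement.exponential_stability[OF graphs_from_pair_graph L2 this]
  obtain C2 l2 where C2: "C2 > 0" "0 < l2" "l2 < 1"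
    and decay2: "\<forall>t0\<ge>1. \<forall>w d. disagreement.trajectory (\<lambda>t. pair_graph (N t)) t0 w \<longrightarrow>
      (\<forall>a\<in>V \<times> V. norm (w t0 a) \<le> d) \<longrightarrow>
      (\<forall>k. \<forall>a\<in>V \<times> V. norm (w (t0 + k) a) \<le> C2 * l2 ^ k * d)"
    by blast
  define l where "l = max l1 l2"
  define C where "C = max C1 C2"
  have l: "0 \<le> l" "l < 1" and C: "C > 0" using C1 C2 by (auto simp: l_def C_def)
  have weaken: "C' * l' ^ k * d \<le> C * l ^ k * d"
    if "C' \<le> C" "0 \<le> C'" "0 \<le> l'" "l' \<le> l" "0 \<le> d" for C' l' k d
    using that by (intro mult_right_mono mult_mono power_mono) auto
  \<comment> \<open>In terms of the distance to the limit: 1 for the residual, 2 for the disagreement with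
    agent 1, and \<open>2 / (1 - l)\<close> for the distance of agent 1 from its limit.\<close>
  define c where "c = C * (3 + 2 / (1 - l))"
  have c: "c > 0" using C l by (simp add: c_def add_pos_nonneg)
  have "\<exists>z. mat_vec (stack m A) z = stack m b \<and>
      (\<forall>t\<ge>t0. max_dist m (\<lambda>i. x i t) z \<le> c * l ^ (t - t0) * max_dist m (\<lambda>i. x i t0) z)"
    if t0: "t0 \<ge> 1" and x: "trajectory_from t0 m A N x"
      and init: "\<forall>i\<in>V. mat_vec (A i) (x i t0) = b i" for t0 x
  proof -
    define y where "y = (\<lambda>t i. x i t - z0)"
    define s where "s = (\<lambda>t i. Q (y t i))"
    define w where "w = (\<lambda>t i. y t i - Q (y t i))"
    have stepR: "y (Suc t) i = R i (mean (y t) (preds (N t) i))"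
      if "t \<ge> t0" "i \<in> V" "y t i \<in> ker (A i)" for t i
      using centered_step[OF that(1) t0 x that(2), of z0] that(3) by (simp add: y_def)
    have y_ker: "y t i \<in> ker (A i)" if "t \<ge> t0" "i \<in> V" for t i
      using that
    proof (induction t arbitrary: i rule: dec_induct)
      case base
      have "mat_vec (A i) (x i t0) = mat_vec (A i) z0" using init sol z0 base by simp
      then show ?case by (simp add: y_def mat_vec_eq_iff)
    next
      case (step t)
      have "y (Suc t) i = R i (mean (y t) (preds (N t) i))"
        by (rule stepR[OF step.hyps(1) step.prems step.IH[OF step.prems]])
      then show ?case using orth_proj_in[OF subspace_ker] by simp
    qed
    have y_step: "y (Suc t) i = R i (mean (y t) (preds (N t) i))" if "t \<ge> t0" "i \<in> V" for t i
      using stepR y_ker that by blast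
    have s_step: "s (Suc t) i = mean (s t) (preds (N t) i)" if "t \<ge> t0" "i \<in> V" for t i
      using that by (simp add: s_def y_step Q_R mean_linear[OF matrix_vector_mul_linear])
    have "residual.trajectory N t0 w"
      unfolding residual.trajectory_def
    proof (intro allI impI ballI)
      fix t i assume t: "t \<ge> t0" and i: "i \<in> V"
      let ?u = "mean (y t) (preds (N t) i)"
      have "linear (\<lambda>u. u - Q u)"
        by (intro linear_compose_sub linear_ident matrix_vector_mul_linear)
      from mean_linear[OF this] have "mean (w t) (preds (N t) i) = ?u - Q ?u"
        unfolding w_def by (rule sym)
      then have "avg_step residual (N t) (w t) i = R i ?u - Q ?u"
        using i by (simp add: avg_step_def residual_eq matrix_vector_mult_diff_distrib R_Q Q_Q)
      then show "w (Suc t) i = avg_step residual (N t) (w t) i"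
        using t i by (simp add: w_def y_step Q_R)
    qed
    with decay1 t0 have w_decay1: "\<forall>d. (\<forall>i\<in>V. norm (w t0 i) \<le> d) \<longrightarrow>
        (\<forall>k. \<forall>i\<in>V. norm (w (t0 + k) i) \<le> C1 * l1 ^ k * d)" by blast
    have w_decay: "norm (w (t0 + k) i) \<le> C * l ^ k * d"
      if "\<forall>i\<in>V. norm (w t0 i) \<le> d" "0 \<le> d" "i \<in> V" for d k i
    proof -
      have "norm (w (t0 + k) i) \<le> C1 * l1 ^ k * d" using w_decay1 that by blast
      also have "\<dots> \<le> C * l ^ k * d"
        using C1 that(2) by (intro weaken) (simp_all add: C_def l_def)
      finally show ?thesis .
    qed
    have "disagreement.trajectory (\<lambda>t. pair_graph (N t)) t0 (\<lambda>t (i, j). s t i - s t j)"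
      unfolding disagreement.trajectory_def
    proof (intro allI impI ballI)
      fix t a assume t: "t \<ge> t0" and a: "a \<in> V \<times> V"
      obtain i j where ij: "a = (i, j)" "i \<in> V" "j \<in> V" using a by blast
      have B: "finite (preds (N t) i)" "preds (N t) i \<noteq> {}" "finite (preds (N t) j)" "preds (N t) j \<noteq> {}"
        using preds_N t t0 ij by simp_all
      have "s (Suc t) i - s (Suc t) j = mean (\<lambda>(p, q). s t p - s t q) (preds (pair_graph (N t)) a)"
        using s_step t ij B by (simp add: preds_pair_graph mean_Times_diff)
      then show "(case a of (i, j) \<Rightarrow> s (Suc t) i - s (Suc t) j) =
          avg_step off_diagonal (pair_graph (N t)) (\<lambda>(i, j). s t i - s t j) a"
        using ij by (auto simp: avg_step_def off_diagonal_def)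
    qed
    from decay2[rule_format, OF t0 this]
    have s_decay2: "norm (s (t0 + k) i - s (t0 + k) j) \<le> C2 * l2 ^ k * d"
      if "\<forall>(i, j)\<in>V \<times> V. norm (s t0 i - s t0 j) \<le> d" "i \<in> V" "j \<in> V" for d k i j
      using that(1) SigmaI[OF that(2,3)] by fastforce
    have s_decay: "norm (s (t0 + k) i - s (t0 + k) j) \<le> C * l ^ k * d"
      if "\<forall>(i, j)\<in>V \<times> V. norm (s t0 i - s t0 j) \<le> d" "0 \<le> d" "i \<in> V" "j \<in> V" for d k i j
    proof -
      have "norm (s (t0 + k) i - s (t0 + k) j) \<le> C2 * l2 ^ k * d"
        by (rule s_decay2[OF that(1,3,4)])
      also have "\<dots> \<le> C * l ^ k * d"
        using C2 that(2) by (intro weaken) (simp_all add: C_def l_def)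
      finally show ?thesis .
    qed
    define D where "D = Max ((\<lambda>(i, j). norm (s t0 i - s t0 j)) ` (V \<times> V))"
    have D_le: "D \<le> d" if "\<forall>(i, j)\<in>V \<times> V. norm (s t0 i - s t0 j) \<le> d" for d
      unfolding D_def using that V by (subst Max_le_iff) auto
    have D_ge: "\<forall>(i, j)\<in>V \<times> V. norm (s t0 i - s t0 j) \<le> D"
      unfolding D_def by (auto intro!: Max_ge)
    then have D0: "0 \<le> D" using V(2) norm_ge_zero order_trans by blast
    have "norm (s (t0 + Suc k) 1 - s (t0 + k) 1) \<le> C * D * l ^ k" for k
    proof -
      let ?B = "preds (N (t0 + k)) 1"
      have B: "finite ?B" "?B \<noteq> {}" "?B \<subseteq> V"
        using preds_N[of "t0 + k" 1] t0 V by simp_all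
      have "s (t0 + Suc k) 1 - s (t0 + k) 1 = mean (\<lambda>(p, q). s (t0 + k) p - s (t0 + k) q) (?B \<times> {1})"
        using B V s_step[of "t0 + k" 1] by (simp add: mean_Times_diff mean_singleton)
      also have "norm \<dots> \<le> C * l ^ k * D"
        using B V s_decay[OF D_ge D0] by (intro norm_mean_le) auto
      finally show ?thesis by (simp add: mult.commute mult.left_commute)
    qed
    then obtain z' where lim: "(\<lambda>k. s (t0 + k) 1) \<longlonglongrightarrow> z'"
      and z'_rate: "\<And>k. norm (s (t0 + k) 1 - z') \<le> C * D * l ^ k / (1 - l)"
      using geometric_increments_converge[OF l, of "\<lambda>k. s (t0 + k) 1" "C * D"] by auto
    have "z' \<in> common_ker"
      by (rule closed_sequentially[OF closed_subspace[OF subspace_common_ker] _ lim])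
        (simp add: s_def orth_proj_in[OF subspace_common_ker])
    then have Qz': "Q z' = z'" by (intro orth_proj_fixes subspace_common_ker)
    define z where "z = z0 + z'"
    have "mat_vec (stack m A) z = stack m b"
    proof -
      have "mat_vec (A i) z = b i" if "i \<in> V" for i
        using that sol z0 \<open>z' \<in> common_ker\<close> common_ker_subset[OF that] mat_vec_eq_iff[of "A i" z z0]
        by (auto simp: z_def)
      then show ?thesis using sol by blast
    qed
    moreover have "max_dist m (\<lambda>i. x i t) z \<le> c * l ^ (t - t0) * max_dist m (\<lambda>i. x i t0) z"
      if t: "t \<ge> t0" for t
    proof -
      define M where "M = max_dist m (\<lambda>i. x i t0) z"
      define k where "k = t - t0"
      have tk: "t = t0 + k" using t by (simp add: k_def)
      have xM: "norm (x i t0 - z) \<le> M" if "i \<in> V" for i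
        using norm_le_max_dist[OF that] by (simp add: M_def)
      have M0: "0 \<le> M" using xM[OF V(2)] norm_ge_zero order_trans by blast
      have y0: "y t0 i = (x i t0 - z) + z'" for i by (simp add: y_def z_def)
      have sM: "norm (s t0 i - z') \<le> M" if "i \<in> V" for i
      proof -
        have "s t0 i - z' = Q (x i t0 - z)"
          by (simp add: s_def y0 matrix_vector_right_distrib Qz')
        also have "norm \<dots> \<le> norm (x i t0 - z)"
          by (intro norm_le_if_inner_eq inner_orth_proj subspace_common_ker)
        finally show ?thesis using xM[OF that] by linarith
      qed
      have "norm (s t0 i - s t0 j) \<le> 2 * M" if "i \<in> V" "j \<in> V" for i j
        using norm_triangle_ineq4[of "s t0 i - z'" "s t0 j - z'"] sM[OF that(1)] sM[OF that(2)]
        by simp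
      then have DM: "D \<le> 2 * M" by (intro D_le) auto
      have "norm (w t0 i) \<le> M" if "i \<in> V" for i
      proof -
        let ?v = "x i t0 - z"
        have "(?v - Q ?v) \<bullet> Q ?v = 0"
          by (intro orth_proj_orthogonal orth_proj_in subspace_common_ker)
        then have "norm (?v - Q ?v) \<le> norm ?v"
          by (intro norm_le_if_inner_eq) (simp add: inner_diff_right)
        moreover have "w t0 i = ?v - Q ?v"
          by (simp add: w_def y0 matrix_vector_right_distrib Qz')
        ultimately show ?thesis using xM[OF that] by simp
      qed
      then have wM: "norm (w t i) \<le> C * l ^ k * M" if "i \<in> V" for i
        using w_decay[OF _ M0 that] unfolding tk by blast
      have "norm (x i t - z) \<le> c * l ^ k * M" if i: "i \<in> V" for i
      proof -
        have "x i t - z = w t i + (s t i - s t 1) + (s t 1 - z')"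
          by (simp add: w_def s_def y_def z_def)
        then have "norm (x i t - z) \<le> norm (w t i) + norm (s t i - s t 1) + norm (s t 1 - z')"
          by (metis norm_triangle_mono norm_triangle_ineq order_refl)
        also have "\<dots> \<le> C * l ^ k * M + C * l ^ k * D + C * D * l ^ k / (1 - l)"
          using wM[OF i] s_decay[OF D_ge D0 i V(2), of k] z'_rate[of k] unfolding tk by linarith
        also have "\<dots> = C * l ^ k * (M + D + D / (1 - l))"
          by (simp add: algebra_simps)
        also have "\<dots> \<le> C * l ^ k * (M + 2 * M + 2 * M / (1 - l))"
          using C l DM by (intro mult_left_mono add_mono divide_right_mono) auto
        also have "\<dots> = c * l ^ k * M"
          by (simp add: c_def algebra_simps)
        finally show ?thesis .
      qed
      then show ?thesis by (simp add: max_dist_le_iff M_def k_def)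
    qed
    ultimately show ?thesis by blast
  qed
  then have "converges_at_rate m A b N l"
    unfolding converges_at_rate_def using c by blast
  then show ?thesis using l by blast
qed

end

theorem theorem2:
  fixes m :: nat
    and A :: "nat \<Rightarrow> ('n::finite) row_matrix"
    and b :: "nat \<Rightarrow> real list"
    and N :: "nat \<Rightarrow> (nat \<times> nat) set"
  assumes "m > 1"
    and "\<And>i. i \<in> {1..m} \<Longrightarrow> length (b i) = length (A i)"
    and "\<exists>y z. y \<noteq> z \<and> mat_vec (stack m A) y = stack m b \<and> mat_vec (stack m A) z = stack m b"
    and "stack m A \<noteq> replicate (length (stack m A)) 0"
    and "\<And>t. t \<ge> 1 \<Longrightarrow> N t \<subseteq> {1..m} \<times> {1..m}"
    and "\<And>t i. t \<ge> 1 \<Longrightarrow> i \<in> {1..m} \<Longrightarrow> (i, i) \<in> N t"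
  shows "(\<exists>\<mu>::real. 0 \<le> \<mu> \<and> \<mu> < 1 \<and> converges_at_rate m A b N \<mu>) \<longleftrightarrow>
    repeatedly_jointly (rooted m) N \<and> repeatedly_jointly (D_connected m A) N"
proof -
  interpret agents m A N
    using assms(1,5,6) by unfold_locales auto
  note sol = solves_stack_iff[OF assms(2)]
  obtain y z where yz: "y \<noteq> z" "mat_vec (stack m A) y = stack m b" "mat_vec (stack m A) z = stack m b"
    using assms(3) by blast
  have "y - z \<in> ker (A i)" if "i \<in> {1..m}" for i
    using sol yz(2,3) that by (simp flip: mat_vec_eq_iff)
  then have "y - z \<in> common_ker"
    by (simp add: common_ker_def)
  moreover have "y - z \<noteq> 0" using yz(1) by simp
  ultimately show ?thesis
    using necessity[OF _ _ _ sol yz(3)] sufficiency[OF _ _ sol yz(3)] by blast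
qed

end
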